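(* Let $\prec$ be a well-order on $\mathbb{N}$ with order type $|{\prec}|$, and let $h\in\omega$. If $\pi=(\tau,\lambda)$ is an $I\Sigma_1(X)$-derivation of $TI(\prec)$ in free variable normal form without redundancy and $|{\prec}|>\omega^{h+1}+\omega$, then $height(\pi)>h$, where $height(\pi)$ is the height of the tree $\tau$. In particular, if $|{\prec}|\ge\omega^{\omega}$, then $I\Sigma_1(X)\not\vdash TI(\prec)$.
   Context: **Arithmetic.** Formulas are in negation normal form over $\lnot,\land,\lor,\forall,\exists$; $\overline{\varphi}$ is the negation normal form of $\lnot\varphi$. $\mathcal{L}_{\mathbb{N}}$ is the language with a symbol for every function and predicate on $\mathbb{N}$ (so in particular for $=,\le,\prec$), and $\mathcal{L}_{\mathbb{N}}(X)=\mathcal{L}_{\mathbb{N}}\cup\{X\}$ with $X$ a fresh unary predicate; $X(x)$ is written $x\in X$. $\Delta_0$ (resp. $\Delta_0(X)$) is the class of bounded $\mathcal{L}_{\mathbb{N}}$- (resp. $\mathcal{L}_{\mathbb{N}}(X)$-) formulas. $p\Sigma_i$ is the class of $\mathcal{L}_{\mathbb{N}}$-formulas $\exists x_1\forall x_2\cdots\psi$ with exactly $i$ alternating unbounded quantifiers beginning with $\exists$, where $\psi$ is a maximal $\Delta_0$-subformula; $p\Sigma_i(X)$ is the same with $\Delta_0(X)$. $Th(\mathbb{N})$ is the set of all $\mathcal{L}_{\mathbb{N}}$-sentences in $\bigcup_i p\Sigma_i$ true in $\mathbb{N}$. $I\Sigma_k(X)$ is $Th(\mathbb{N})$ together with the scheme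 $(\varphi(0)\land\forall x(\varphi(x)\to\varphi(x+1)))\to\forall x\,\varphi(x)$ for $\varphi\in p\Sigma_k(X)$. A sequent is a finite set of formulas, read as the universal closure of its disjunction. $TI(\prec)$ is the sequent $$\{\forall y.\ \overline{y\in X},\ \ \exists x_0\forall x.\,(x_0\in X\land(\overline{x\in X}\lor\overline{x\prec x_0}))\},$$ and $I\Sigma_k(X)\vdash TI(\prec)$ means that the disjunction of these two sentences is provable in first-order logic from $I\Sigma_k(X)$. **Derivations.** $var(t)$ is the set of variables of a term $t$, and $fv$ denotes the set of free variables of a formula or sequent. A rooted tree is a nonempty set of finite sequences of natural numbers closed under initial segments; its height is the maximal length of its elements; the children of $v$ are the elements $v*k$ ($v$ extended by one entry $k$). An $I\Sigma_k(X)$-derivation of a sequent $S$ in free variable normal form without redundancy is a pair $\pi=(\tau,\lambda)$ with $\tau$ a finite rooted tree and $\lambda$ assigning a sequent to each node, such that $\lambda(\emptyset)=S$ and, for each $v\in\tau$, the sequent $\Gamma:=\lambda(v)$ follows from the labels of the children of $v$ by one of these rules (where $\Gamma,\varphi$ means $\Gamma\cup\{\varphi\}$): - Initial Sequent: no premises; $\Gamma$ contains $L$ and $\overline{L}$ for some literal $L$. - $\lor$-Rule: premise $\Gamma,\varphi_{i_0}$, where $\varphi_1\lor\varphi_2\in\Gamma$, $i_0\in\{1,2\}$, $\varphi_{i_0}\notin\Gamma$. - $\exists$-Rule: premise $\Gamma,\varphi(u)$, where $\exists x.\varphi(x)\in\Gamma$, $u$ is an $\mathcal{L}_{\mathbb{N}}$-term,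 $var(u)\subseteq fv(\Gamma\cup\{\varphi(u)\})=fv(\Gamma)$, $\varphi(u)\notin\Gamma$. - $\land$-Rule: premises $\Gamma,\varphi_1$ and $\Gamma,\varphi_2$, where $\varphi_1\land\varphi_2\in\Gamma$, $\varphi_1,\varphi_2\notin\Gamma$. - $\forall$-Rule: premise $\Gamma,\varphi(a)$, where $\forall x.\varphi(x)\in\Gamma$, $a\notin fv(\Gamma)$, $\varphi(a)\notin\Gamma$, $fv(\Gamma\cup\{\varphi(a)\})\subseteq fv(\Gamma)\cup\{a\}$. - True Sentence: premise $\Gamma,\overline{\varphi}$, where $\varphi\in Th(\mathbb{N})$, $\overline{\varphi}\notin\Gamma$. - $p\Sigma_k(X)$-Induction: premises $\Gamma,\varphi(0)$; $\ \Gamma,\overline{\varphi(a)},\varphi(a+1)$; $\ \Gamma,\overline{\varphi(t)}$, where $t$ is an $\mathcal{L}_{\mathbb{N}}$-term with $var(t)\subseteq fv(\varphi(t))$, $\varphi(x)\in p\Sigma_k(X)$, $\varphi(0)\notin\Gamma$, $\varphi(t)\notin\Gamma$, $a\notin fv(\Gamma\cup\{\varphi(0)\})=fv(\Gamma\cup\{\overline{\varphi(t)}\})=fv(\Gamma)$, and $fv(\Gamma\cup\{\overline{\varphi(a)},\varphi(a+1)\})=fv(\Gamma)\cup\{a\}$. - $p\Sigma_k(X)$-Cut: premises $\Gamma,\varphi$ and $\Gamma,\overline{\varphi}$, where $\varphi\in p\Sigma_k(X)$, $\varphi,\overline{\varphi}\notin\Gamma$, $fv(\Gamma\cup\{\varphi\})=fv(\Gamma\cup\{\overline{\varphi}\})=fv(\Gamma)$.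 *)

theory Defs
  imports Main "HOL-Library.FuncSet"
begin

unbundle cardinal_syntax

text \<open>
  An \<open>n\<close>-ary function or predicate on the natural numbers is represented by a function on lists
  that is \<^const>\<open>undefined\<close> outside the lists of length \<open>n\<close>, so that (together with the number of
  arguments it is applied to) every function and every predicate is its own, unique symbol.
  Arities are checked by the well-formedness predicates below.

  Variables are de Bruijn indices: under \<open>d\<close> quantifiers, index \<open>i < d\<close> is bound and index
  \<open>d + n\<close> is the free variable \<open>n\<close>.  Formulas differing only in the names of bound variables are
  thus identified.  A formula \<open>\<phi>(x)\<close> with a distinguished variable \<open>x\<close> is a formula in which index
  \<open>0\<close> plays the role of \<open>x\<close> and index \<open>n + 1\<close> that of the free variable \<open>n\<close>; \<open>\<phi>(u)\<close> is
  \<open>inst u \<phi>\<close>.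
\<close>

datatype tm = Var nat | Fn "nat list \<Rightarrow> nat" "tm list"

datatype atom = Pred "nat list \<Rightarrow> bool" "tm list" | InX tm

datatype fm =
    Pos atom
  | Neg atom
  | Conj fm fm
  | Disj fm fm
  | All fm
  | Ex fm

fun wf_tm :: "tm \<Rightarrow> bool" where
  "wf_tm (Var n) \<longleftrightarrow> True"
| "wf_tm (Fn f ts) \<longleftrightarrow>
     f \<in> extensional {xs. length xs = length ts} \<and> (\<forall>t\<in>set ts. wf_tm t)"

primrec wf_atom :: "atom \<Rightarrow> bool" where
  "wf_atom (Pred p ts) \<longleftrightarrow>
     p \<in> extensional {xs. length xs = length ts} \<and> (\<forall>t\<in>set ts. wf_tm t)"
| "wf_atom (InX t) \<longleftrightarrow> wf_tm t"

primrec wf_fm :: "fm \<Rightarrow> bool" where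
  "wf_fm (Pos a) \<longleftrightarrow> wf_atom a"
| "wf_fm (Neg a) \<longleftrightarrow> wf_atom a"
| "wf_fm (Conj \<phi> \<psi>) \<longleftrightarrow> wf_fm \<phi> \<and> wf_fm \<psi>"
| "wf_fm (Disj \<phi> \<psi>) \<longleftrightarrow> wf_fm \<phi> \<and> wf_fm \<psi>"
| "wf_fm (All \<phi>) \<longleftrightarrow> wf_fm \<phi>"
| "wf_fm (Ex \<phi>) \<longleftrightarrow> wf_fm \<phi>"

text \<open>\<open>X_free \<phi>\<close>: \<open>\<phi>\<close> belongs to the sublanguage $\mathcal{L}_{\mathbb{N}}$.\<close>

primrec X_free :: "fm \<Rightarrow> bool" where
  "X_free (Pos a) \<longleftrightarrow> (\<forall>t. a \<noteq> InX t)"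
| "X_free (Neg a) \<longleftrightarrow> (\<forall>t. a \<noteq> InX t)"
| "X_free (Conj \<phi> \<psi>) \<longleftrightarrow> X_free \<phi> \<and> X_free \<psi>"
| "X_free (Disj \<phi> \<psi>) \<longleftrightarrow> X_free \<phi> \<and> X_free \<psi>"
| "X_free (All \<phi>) \<longleftrightarrow> X_free \<phi>"
| "X_free (Ex \<phi>) \<longleftrightarrow> X_free \<phi>"

primrec neg :: "fm \<Rightarrow> fm" where
  "neg (Pos a) = Neg a"
| "neg (Neg a) = Pos a"
| "neg (Conj \<phi> \<psi>) = Disj (neg \<phi>) (neg \<psi>)"
| "neg (Disj \<phi> \<psi>) = Conj (neg \<phi>) (neg \<psi>)"
| "neg (All \<phi>) = Ex (neg \<phi>)"
| "neg (Ex \<phi>) = All (neg \<phi>)"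

definition imp :: "fm \<Rightarrow> fm \<Rightarrow> fm" where
  "imp \<phi> \<psi> = Disj (neg \<phi>) \<psi>"

primrec var_tm :: "tm \<Rightarrow> nat set" where
  "var_tm (Var n) = {n}"
| "var_tm (Fn f ts) = \<Union> (set (map var_tm ts))"

primrec fv_atom :: "atom \<Rightarrow> nat set" where
  "fv_atom (Pred p ts) = \<Union> (set (map var_tm ts))"
| "fv_atom (InX t) = var_tm t"

primrec fv :: "fm \<Rightarrow> nat set" where
  "fv (Pos a) = fv_atom a"
| "fv (Neg a) = fv_atom a"
| "fv (Conj \<phi> \<psi>) = fv \<phi> \<union> fv \<psi>"
| "fv (Disj \<phi> \<psi>) = fv \<phi> \<union> fv \<psi>"
| "fv (All \<phi>) = {n. Suc n \<in> fv \<phi>}"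
| "fv (Ex \<phi>) = {n. Suc n \<in> fv \<phi>}"

primrec subst_tm :: "(nat \<Rightarrow> tm) \<Rightarrow> tm \<Rightarrow> tm" where
  "subst_tm \<sigma> (Var n) = \<sigma> n"
| "subst_tm \<sigma> (Fn f ts) = Fn f (map (subst_tm \<sigma>) ts)"

primrec subst_atom :: "(nat \<Rightarrow> tm) \<Rightarrow> atom \<Rightarrow> atom" where
  "subst_atom \<sigma> (Pred p ts) = Pred p (map (subst_tm \<sigma>) ts)"
| "subst_atom \<sigma> (InX t) = InX (subst_tm \<sigma> t)"

definition lift_tm :: "tm \<Rightarrow> tm" where
  "lift_tm = subst_tm (\<lambda>n. Var (Suc n))"

definition lift_sub :: "(nat \<Rightarrow> tm) \<Rightarrow> nat \<Rightarrow> tm" where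
  "lift_sub \<sigma> = case_nat (Var 0) (\<lambda>n. lift_tm (\<sigma> n))"

primrec subst_fm :: "(nat \<Rightarrow> tm) \<Rightarrow> fm \<Rightarrow> fm" where
  "subst_fm \<sigma> (Pos a) = Pos (subst_atom \<sigma> a)"
| "subst_fm \<sigma> (Neg a) = Neg (subst_atom \<sigma> a)"
| "subst_fm \<sigma> (Conj \<phi> \<psi>) = Conj (subst_fm \<sigma> \<phi>) (subst_fm \<sigma> \<psi>)"
| "subst_fm \<sigma> (Disj \<phi> \<psi>) = Disj (subst_fm \<sigma> \<phi>) (subst_fm \<sigma> \<psi>)"
| "subst_fm \<sigma> (All \<phi>) = All (subst_fm (lift_sub \<sigma>) \<phi>)"
| "subst_fm \<sigma> (Ex \<phi>) = Ex (subst_fm (lift_sub \<sigma>) \<phi>)"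

definition inst :: "tm \<Rightarrow> fm \<Rightarrow> fm" where
  "inst u = subst_fm (case_nat u Var)"

definition pred2 :: "(nat \<Rightarrow> nat \<Rightarrow> bool) \<Rightarrow> tm \<Rightarrow> tm \<Rightarrow> atom" where
  "pred2 R s t = Pred (restrict (\<lambda>xs. R (xs ! 0) (xs ! 1)) {xs. length xs = 2}) [s, t]"

definition zero_tm :: tm where
  "zero_tm = Fn (restrict (\<lambda>xs. 0) {xs. length xs = 0}) []"

definition one_tm :: tm where
  "one_tm = Fn (restrict (\<lambda>xs. 1) {xs. length xs = 0}) []"

definition plus_tm :: "tm \<Rightarrow> tm \<Rightarrow> tm" where
  "plus_tm s t = Fn (restrict (\<lambda>xs. xs ! 0 + xs ! 1) {xs. length xs = 2}) [s, t]"

primrec eval :: "(nat \<Rightarrow> nat) \<Rightarrow> tm \<Rightarrow> nat" where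
  "eval e (Var n) = e n"
| "eval e (Fn f ts) = f (map (eval e) ts)"

primrec sat_atom :: "nat set \<Rightarrow> (nat \<Rightarrow> nat) \<Rightarrow> atom \<Rightarrow> bool" where
  "sat_atom S e (Pred p ts) \<longleftrightarrow> p (map (eval e) ts)"
| "sat_atom S e (InX t) \<longleftrightarrow> eval e t \<in> S"

primrec sat :: "nat set \<Rightarrow> (nat \<Rightarrow> nat) \<Rightarrow> fm \<Rightarrow> bool" where
  "sat S e (Pos a) \<longleftrightarrow> sat_atom S e a"
| "sat S e (Neg a) \<longleftrightarrow> \<not> sat_atom S e a"
| "sat S e (Conj \<phi> \<psi>) \<longleftrightarrow> sat S e \<phi> \<and> sat S e \<psi>"
| "sat S e (Disj \<phi> \<psi>) \<longleftrightarrow> sat S e \<phi> \<or> sat S e \<psi>"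
| "sat S e (All \<phi>) \<longleftrightarrow> (\<forall>n. sat S (case_nat n e) \<phi>)"
| "sat S e (Ex \<phi>) \<longleftrightarrow> (\<exists>n. sat S (case_nat n e) \<phi>)"

text \<open>
  Bounded quantifiers are $\forall x(\overline{x \le t} \lor \varphi)$ and
  $\exists x(x \le t \land \varphi)$; lifting \<open>t\<close> expresses that \<open>x\<close> does not occur in it.
\<close>

inductive_set Delta0X :: "fm set" where
  pos: "wf_atom a \<Longrightarrow> Pos a \<in> Delta0X"
| neg: "wf_atom a \<Longrightarrow> Neg a \<in> Delta0X"
| conj: "\<phi> \<in> Delta0X \<Longrightarrow> \<psi> \<in> Delta0X \<Longrightarrow> Conj \<phi> \<psi> \<in> Delta0X"
| disj: "\<phi> \<in> Delta0X \<Longrightarrow> \<psi> \<in> Delta0X \<Longrightarrow> Disj \<phi> \<psi> \<in> Delta0X"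
| ball: "wf_tm t \<Longrightarrow> \<phi> \<in> Delta0X \<Longrightarrow>
    All (Disj (Neg (pred2 (\<le>) (Var 0) (lift_tm t))) \<phi>) \<in> Delta0X"
| bex: "wf_tm t \<Longrightarrow> \<phi> \<in> Delta0X \<Longrightarrow>
    Ex (Conj (Pos (pred2 (\<le>) (Var 0) (lift_tm t))) \<phi>) \<in> Delta0X"

text \<open>
  The side conditions \<open>\<notin> Delta0X\<close> say that the matrix is a \<^emph>\<open>maximal\<close> bounded subformula, i.e.
  that no quantifier of the prefix is itself a bounded one.
\<close>

fun pSigmaX :: "nat \<Rightarrow> fm set" and pPiX :: "nat \<Rightarrow> fm set" where
  "pSigmaX 0 = Delta0X"
| "pSigmaX (Suc i) = {Ex \<phi> |\<phi>. \<phi> \<in> pPiX i \<and> Ex \<phi> \<notin> Delta0X}"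
| "pPiX 0 = Delta0X"
| "pPiX (Suc i) = {All \<phi> |\<phi>. \<phi> \<in> pSigmaX i \<and> All \<phi> \<notin> Delta0X}"

definition pSigma :: "nat \<Rightarrow> fm set" where
  "pSigma i = {\<phi> \<in> pSigmaX i. X_free \<phi>}"

text \<open>The set \<open>S\<close> interpreting \<open>X\<close> and the assignment \<open>e\<close> are irrelevant for $\mathcal{L}_{\mathbb{N}}$-sentences.\<close>

definition ThN :: "fm set" where
  "ThN = {\<phi> \<in> (\<Union>i. pSigma i). fv \<phi> = {} \<and> (\<forall>S e. sat S e \<phi>)}"

definition ind_axiom :: "fm \<Rightarrow> fm" where
  "ind_axiom \<phi> =
     imp (Conj (inst zero_tm \<phi>)
               (All (imp \<phi> (subst_fm (case_nat (plus_tm (Var 0) one_tm) (\<lambda>n. Var (Suc n))) \<phi>))))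
         (All \<phi>)"

text \<open>Induction axioms may contain parameters; free variables in axioms are read universally.\<close>

definition ISigmaX :: "nat \<Rightarrow> fm set" where
  "ISigmaX k = ThN \<union> ind_axiom ` pSigmaX k"

definition sequent :: "fm set \<Rightarrow> bool" where
  "sequent \<Gamma> \<longleftrightarrow> finite \<Gamma> \<and> (\<forall>\<phi>\<in>\<Gamma>. wf_fm \<phi>)"

definition FV :: "fm set \<Rightarrow> nat set" where
  "FV \<Gamma> = (\<Union>\<phi>\<in>\<Gamma>. fv \<phi>)"

text \<open>
  First-order provability of a sequent from a set of axioms, as a Tait calculus with unrestricted
  cut.  Equality is one of the predicate symbols of $\mathcal{L}_{\mathbb{N}}$, governed by the
  axioms in \<^const>\<open>ThN\<close>, and not a logical symbol.  The rule \<open>ax\<close> admits axioms with free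
  variables, whose universal closures are then derivable.
\<close>

inductive fol_provable :: "fm set \<Rightarrow> fm set \<Rightarrow> bool"  (infix \<open>\<turnstile>\<close> 50) for T :: "fm set" where
  init: "sequent \<Gamma> \<Longrightarrow> Pos a \<in> \<Gamma> \<Longrightarrow> Neg a \<in> \<Gamma> \<Longrightarrow> T \<turnstile> \<Gamma>"
| ax: "sequent \<Gamma> \<Longrightarrow> \<phi> \<in> T \<Longrightarrow> \<phi> \<in> \<Gamma> \<Longrightarrow> T \<turnstile> \<Gamma>"
| disj: "Disj \<phi>\<^sub>1 \<phi>\<^sub>2 \<in> \<Gamma> \<Longrightarrow> \<phi> \<in> {\<phi>\<^sub>1, \<phi>\<^sub>2} \<Longrightarrow> T \<turnstile> insert \<phi> \<Gamma> \<Longrightarrow> T \<turnstile> \<Gamma>"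
| conj: "Conj \<phi>\<^sub>1 \<phi>\<^sub>2 \<in> \<Gamma> \<Longrightarrow> T \<turnstile> insert \<phi>\<^sub>1 \<Gamma> \<Longrightarrow> T \<turnstile> insert \<phi>\<^sub>2 \<Gamma> \<Longrightarrow> T \<turnstile> \<Gamma>"
| ex: "Ex \<phi> \<in> \<Gamma> \<Longrightarrow> wf_tm u \<Longrightarrow> T \<turnstile> insert (inst u \<phi>) \<Gamma> \<Longrightarrow> T \<turnstile> \<Gamma>"
| all: "All \<phi> \<in> \<Gamma> \<Longrightarrow> a \<notin> FV \<Gamma> \<Longrightarrow> T \<turnstile> insert (inst (Var a) \<phi>) \<Gamma> \<Longrightarrow> T \<turnstile> \<Gamma>"
| cut: "wf_fm \<phi> \<Longrightarrow> T \<turnstile> insert \<phi> \<Gamma> \<Longrightarrow> T \<turnstile> insert (neg \<phi>) \<Gamma> \<Longrightarrow> T \<turnstile> \<Gamma>"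

definition TI_hyp :: fm where
  "TI_hyp = All (Neg (InX (Var 0)))"

definition TI_concl :: "(nat \<Rightarrow> nat \<Rightarrow> bool) \<Rightarrow> fm" where
  "TI_concl prec =
     Ex (All (Conj (Pos (InX (Var 1)))
                   (Disj (Neg (InX (Var 0))) (Neg (pred2 prec (Var 0) (Var 1))))))"

definition TI :: "(nat \<Rightarrow> nat \<Rightarrow> bool) \<Rightarrow> fm set" where
  "TI prec = {TI_hyp, TI_concl prec}"

definition ISigmaX_proves_TI :: "nat \<Rightarrow> (nat \<Rightarrow> nat \<Rightarrow> bool) \<Rightarrow> bool" where
  "ISigmaX_proves_TI k prec \<longleftrightarrow> ISigmaX k \<turnstile> {Disj TI_hyp (TI_concl prec)}"

text \<open>\<open>rule_inst k Ps \<Gamma>\<close>: the sequent \<open>\<Gamma>\<close> follows from the list \<open>Ps\<close> of premises by one rule.\<close>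

inductive rule_inst :: "nat \<Rightarrow> fm set list \<Rightarrow> fm set \<Rightarrow> bool" for k :: nat where
  initial:
    "Pos a \<in> \<Gamma> \<Longrightarrow> Neg a \<in> \<Gamma> \<Longrightarrow> rule_inst k [] \<Gamma>"
| disj:
    "Disj \<phi>\<^sub>1 \<phi>\<^sub>2 \<in> \<Gamma> \<Longrightarrow> \<phi> \<in> {\<phi>\<^sub>1, \<phi>\<^sub>2} \<Longrightarrow> \<phi> \<notin> \<Gamma> \<Longrightarrow>
     rule_inst k [insert \<phi> \<Gamma>] \<Gamma>"
| ex:
    "Ex \<phi> \<in> \<Gamma> \<Longrightarrow> wf_tm u \<Longrightarrow>
     var_tm u \<subseteq> FV (insert (inst u \<phi>) \<Gamma>) \<Longrightarrow> FV (insert (inst u \<phi>) \<Gamma>) = FV \<Gamma> \<Longrightarrow>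
     inst u \<phi> \<notin> \<Gamma> \<Longrightarrow>
     rule_inst k [insert (inst u \<phi>) \<Gamma>] \<Gamma>"
| conj:
    "Conj \<phi>\<^sub>1 \<phi>\<^sub>2 \<in> \<Gamma> \<Longrightarrow> \<phi>\<^sub>1 \<notin> \<Gamma> \<Longrightarrow> \<phi>\<^sub>2 \<notin> \<Gamma> \<Longrightarrow>
     rule_inst k [insert \<phi>\<^sub>1 \<Gamma>, insert \<phi>\<^sub>2 \<Gamma>] \<Gamma>"
| all:
    "All \<phi> \<in> \<Gamma> \<Longrightarrow> a \<notin> FV \<Gamma> \<Longrightarrow> inst (Var a) \<phi> \<notin> \<Gamma> \<Longrightarrow>
     FV (insert (inst (Var a) \<phi>) \<Gamma>) \<subseteq> FV \<Gamma> \<union> {a} \<Longrightarrow>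
     rule_inst k [insert (inst (Var a) \<phi>) \<Gamma>] \<Gamma>"
| true_sentence:
    "\<phi> \<in> ThN \<Longrightarrow> neg \<phi> \<notin> \<Gamma> \<Longrightarrow>
     rule_inst k [insert (neg \<phi>) \<Gamma>] \<Gamma>"
| induction:
    "\<phi> \<in> pSigmaX k \<Longrightarrow> wf_tm t \<Longrightarrow> var_tm t \<subseteq> fv (inst t \<phi>) \<Longrightarrow>
     inst zero_tm \<phi> \<notin> \<Gamma> \<Longrightarrow> inst t \<phi> \<notin> \<Gamma> \<Longrightarrow>
     a \<notin> FV (insert (inst zero_tm \<phi>) \<Gamma>) \<Longrightarrow>
     FV (insert (inst zero_tm \<phi>) \<Gamma>) = FV (insert (neg (inst t \<phi>)) \<Gamma>) \<Longrightarrow>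
     FV (insert (neg (inst t \<phi>)) \<Gamma>) = FV \<Gamma> \<Longrightarrow>
     FV (\<Gamma> \<union> {neg (inst (Var a) \<phi>), inst (plus_tm (Var a) one_tm) \<phi>}) = FV \<Gamma> \<union> {a} \<Longrightarrow>
     rule_inst k
       [insert (inst zero_tm \<phi>) \<Gamma>,
        \<Gamma> \<union> {neg (inst (Var a) \<phi>), inst (plus_tm (Var a) one_tm) \<phi>},
        insert (neg (inst t \<phi>)) \<Gamma>] \<Gamma>"
| cut:
    "\<phi> \<in> pSigmaX k \<Longrightarrow> \<phi> \<notin> \<Gamma> \<Longrightarrow> neg \<phi> \<notin> \<Gamma> \<Longrightarrow>
     FV (insert \<phi> \<Gamma>) = FV (insert (neg \<phi>) \<Gamma>) \<Longrightarrow> FV (insert (neg \<phi>) \<Gamma>) = FV \<Gamma> \<Longrightarrow>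
     rule_inst k [insert \<phi> \<Gamma>, insert (neg \<phi>) \<Gamma>] \<Gamma>"

definition rooted_tree :: "nat list set \<Rightarrow> bool" where
  "rooted_tree \<tau> \<longleftrightarrow> \<tau> \<noteq> {} \<and> (\<forall>v w. v @ w \<in> \<tau> \<longrightarrow> v \<in> \<tau>)"

definition height :: "nat list set \<Rightarrow> nat" where
  "height \<tau> = Max (length ` \<tau>)"

text \<open>
  In the last clause, \<open>ks\<close> enumerates the children \<open>v @ [k]\<close> of \<open>v\<close> in the order in which their
  labels appear as premises, which need not be the order of the entries \<open>k\<close>.
\<close>

definition derivation :: "nat \<Rightarrow> nat list set \<Rightarrow> (nat list \<Rightarrow> fm set) \<Rightarrow> fm set \<Rightarrow> bool" where
  "derivation k \<tau> lab \<Gamma> \<longleftrightarrow>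
     finite \<tau> \<and> rooted_tree \<tau> \<and> (\<forall>v\<in>\<tau>. sequent (lab v)) \<and> lab [] = \<Gamma> \<and>
     (\<forall>v\<in>\<tau>. \<exists>ks. distinct ks \<and> set ks = {k. v @ [k] \<in> \<tau>} \<and>
        rule_inst k (map (\<lambda>k. lab (v @ [k])) ks) (lab v))"

text \<open>
  Ordinals are represented by (reflexive) well-order relations and compared with \<^const>\<open>ordLess\<close>
  and \<^const>\<open>ordLeq\<close>, which are false unless both arguments are well-orders.
\<close>

definition strict_well_order :: "(nat \<Rightarrow> nat \<Rightarrow> bool) \<Rightarrow> bool" where
  "strict_well_order prec \<longleftrightarrow>
     strict_linear_order {(x, y). prec x y} \<and> wf {(x, y). prec x y}"

definition otp :: "(nat \<Rightarrow> nat \<Rightarrow> bool) \<Rightarrow> nat rel" where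
  "otp prec = {(x, y). prec x y}\<^sup>="

definition ord_plus :: "'a rel \<Rightarrow> 'b rel \<Rightarrow> ('a + 'b) rel"  (infixl \<open>\<oplus>\<^sub>o\<close> 65) where
  "r \<oplus>\<^sub>o s = {(Inl x, Inl y) |x y. (x, y) \<in> r} \<union> {(Inr x, Inr y) |x y. (x, y) \<in> s}
     \<union> {(Inl x, Inr y) |x y. x \<in> Field r \<and> y \<in> Field s}"

text \<open>
  \<open>\<omega>_pow s\<close> is the ordinal power $\omega^s$: functions from \<open>s\<close> to $\omega$ of finite support
  (extended by \<open>0\<close> outside \<open>Field s\<close>), compared at the \<open>s\<close>-largest argument where they differ.
\<close>

definition \<omega>_pow :: "nat rel \<Rightarrow> (nat \<Rightarrow> nat) rel" where
  "\<omega>_pow s = {(f, g).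
     {f, g} \<subseteq> {f. finite {x. f x \<noteq> 0} \<and> {x. f x \<noteq> 0} \<subseteq> Field s} \<and>
     (f = g \<or> (\<exists>z. f z < g z \<and> (\<forall>y. (z, y) \<in> s \<and> y \<noteq> z \<longrightarrow> f y = g y)))}"

lemma strict_well_order_otp:
  assumes "strict_well_order prec"
  shows "well_order (otp prec)"
  using assms
  unfolding strict_well_order_def otp_def well_order_on_def linear_order_on_def partial_order_on_def
    preorder_on_def strict_linear_order_on_def
  by (auto simp: refl_on_def trans_def antisym_def total_on_def irrefl_def
      intro: wf_subset[of "{(x, y). prec x y}"])

lemma Field_otp [simp]: "Field (otp prec) = UNIV"
  by (auto simp: otp_def Field_def)

lemma Well_order_ord_plus:
  assumes r: "Well_order r" and s: "Well_order s"
  shows "Well_order (r \<oplus>\<^sub>o s)"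
proof -
  have F: "Field (r \<oplus>\<^sub>o s) = Inl ` Field r \<union> Inr ` Field s"
    by (force simp: Field_def ord_plus_def)
  have r': "refl_on (Field r) r" "trans r" "antisym r" "total_on (Field r) r"
    and s': "refl_on (Field s) s" "trans s" "antisym s" "total_on (Field s) s"
    using r s by (simp_all add: order_on_defs)
  have "refl_on (Field (r \<oplus>\<^sub>o s)) (r \<oplus>\<^sub>o s)"
    unfolding F using r'(1) s'(1) by (auto simp: refl_on_def ord_plus_def)
  moreover have "r \<oplus>\<^sub>o s \<subseteq> Field (r \<oplus>\<^sub>o s) \<times> Field (r \<oplus>\<^sub>o s)"
    by (auto intro: FieldI1 FieldI2)
  moreover have "trans (r \<oplus>\<^sub>o s)"
    by (rule transI)
      (auto simp: ord_plus_def intro: FieldI1 FieldI2 transD[OF r'(2)] transD[OF s'(2)])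
  moreover have "antisym (r \<oplus>\<^sub>o s)"
    by (rule antisymI) (auto simp: ord_plus_def intro: antisymD[OF r'(3)] antisymD[OF s'(3)])
  moreover have "total_on (Field (r \<oplus>\<^sub>o s)) (r \<oplus>\<^sub>o s)"
  proof -
    have [simp]: "(Inl x, Inl y) \<in> r \<oplus>\<^sub>o s \<longleftrightarrow> (x, y) \<in> r"
      "(Inr v, Inr w) \<in> r \<oplus>\<^sub>o s \<longleftrightarrow> (v, w) \<in> s"
      "(Inl x, Inr w) \<in> r \<oplus>\<^sub>o s \<longleftrightarrow> x \<in> Field r \<and> w \<in> Field s" for x y v w
      by (auto simp: ord_plus_def)
    show ?thesis
      unfolding F total_on_def using r'(4) s'(4) by (simp add: ball_Un total_on_def)
  qed
  moreover have "wf (r \<oplus>\<^sub>o s - Id)"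
    unfolding wf_eq_minimal
  proof (intro allI impI)
    fix Q :: "('a + 'b) set" and x assume x: "x \<in> Q"
    have wr: "wf (r - Id)" and ws: "wf (s - Id)"
      using r s by (simp_all add: order_on_defs)
    show "\<exists>z\<in>Q. \<forall>y. (y, z) \<in> r \<oplus>\<^sub>o s - Id \<longrightarrow> y \<notin> Q"
    proof (cases "Inl -` Q = {}")
      case False
      then obtain z where "z \<in> Inl -` Q" "\<And>y. (y, z) \<in> r - Id \<Longrightarrow> y \<notin> Inl -` Q"
        using wfE_min[OF wr] by (metis ex_in_conv)
      then show ?thesis by (intro bexI[of _ "Inl z"]) (auto simp: ord_plus_def)
    next
      case True
      with x have "Inr -` Q \<noteq> {}" by (cases x) auto
      then obtain z where "z \<in> Inr -` Q" "\<And>y. (y, z) \<in> s - Id \<Longrightarrow> y \<notin> Inr -` Q"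
        using wfE_min[OF ws] by (metis ex_in_conv)
      with True show ?thesis by (intro bexI[of _ "Inr z"]) (auto simp: ord_plus_def)
    qed
  qed
  ultimately show ?thesis by (simp add: order_on_defs)
qed

lemma Well_order_\<omega>_pow_aux:
  assumes s: "s = {(x, y). x \<in> A \<and> y \<in> A \<and> x \<le> y}"
  shows "Well_order (\<omega>_pow s)"
proof -
  define B where "B = {f :: nat \<Rightarrow> nat. finite {x. f x \<noteq> 0} \<and> {x. f x \<noteq> 0} \<subseteq> A}"
  have Fs: "Field s = A" by (auto simp: s Field_def)
  have out: "f x = 0" if "f \<in> B" "x \<notin> A" for f x using that by (auto simp: B_def)
  define L where "L = (\<lambda>f g :: nat \<Rightarrow> nat. \<exists>z. f z < g z \<and> (\<forall>y>z. f y = g y))"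
  have eq: "\<omega>_pow s = {(f, g). f \<in> B \<and> g \<in> B \<and> (f = g \<or> L f g)}"
  proof -
    have "(\<exists>z. f z < g z \<and> (\<forall>y. (z, y) \<in> s \<and> y \<noteq> z \<longrightarrow> f y = g y)) \<longleftrightarrow> L f g"
      if "f \<in> B" "g \<in> B" for f g
    proof -
      have "z \<in> A" if "f z < g z" for z using that out[OF \<open>g \<in> B\<close>] by force
      moreover have "f y = g y" if "y \<notin> A" for y using out[OF \<open>f \<in> B\<close> that] out[OF \<open>g \<in> B\<close> that] by simp
      moreover have "(z, y) \<in> s \<and> y \<noteq> z \<longleftrightarrow> y \<in> A \<and> z < y" if "z \<in> A" for z y
        using that by (auto simp: s)
      ultimately have "(f z < g z \<and> (\<forall>y. (z, y) \<in> s \<and> y \<noteq> z \<longrightarrow> f y = g y)) \<longleftrightarrow>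
          (f z < g z \<and> (\<forall>y>z. f y = g y))" for z
        by meson
      then show ?thesis unfolding L_def by (rule ex_cong1)
    qed
    then show ?thesis unfolding \<omega>_pow_def Fs B_def by auto
  qed
  have F: "Field (\<omega>_pow s) = B" by (auto simp: eq Field_def)
  have Ltrans: "L f h" if fg: "L f g" and gh: "L g h" for f g h
  proof -
    obtain z where z: "f z < g z" "\<forall>y>z. f y = g y" using fg by (auto simp: L_def)
    obtain w where w: "g w < h w" "\<forall>y>w. g y = h y" using gh by (auto simp: L_def)
    show ?thesis unfolding L_def
    proof (intro exI[of _ "max z w"] conjI allI impI)
      show "f (max z w) < h (max z w)"
        using z w by (cases z w rule: linorder_cases) (auto simp: max_def)
    qed (use z w in auto)
  qed
  define d where "d = (\<lambda>f :: nat \<Rightarrow> nat. LEAST d. \<forall>x\<ge>d. f x = 0)"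
  have d: "\<forall>x\<ge>d f. f x = 0" if f: "f \<in> B" for f
  proof -
    obtain m where "\<forall>x\<in>{x. f x \<noteq> 0}. x < m"
      using f finite_nat_set_iff_bounded by (auto simp: B_def)
    then have "\<forall>x\<ge>m. f x = 0" by force
    then show ?thesis unfolding d_def by (rule LeastI)
  qed
  define c where "c = (\<lambda>f. rev (map f [0..<d f]))"
  have code: "(c f, c g) \<in> lenlex less_than" if f: "f \<in> B" and g: "g \<in> B" and L: "L f g" for f g
  proof -
    obtain z where z: "f z < g z" "\<forall>y>z. f y = g y" using L by (auto simp: L_def)
    have zd: "z < d g" using d[OF g] z(1) by (metis not_less not_less_zero)
    then have "\<forall>x\<ge>d g. f x = 0" using d[OF g] z(2) by auto
    then have le: "d f \<le> d g" unfolding fun_cong[OF d_def, of f] by (rule Least_le)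
    have split: "c h = rev (map h [Suc z..<d g]) @ h z # rev (map h [0..<z])" if "d h = d g" for h
    proof -
      have "[0..<d g] = [0..<z] @ z # [Suc z..<d g]"
        using zd upt_add_eq_append[of 0 z "d g - z"] by (simp add: upt_conv_Cons)
      then show ?thesis by (simp add: c_def that)
    qed
    show ?thesis
    proof (cases "d f = d g")
      case True
      have "map f [Suc z..<d g] = map g [Suc z..<d g]" using z(2) by auto
      then have "(c f, c g) \<in> lex less_than"
        using z(1) by (simp only: split[OF True] split[OF refl])
          (auto intro: lex_append_leftI)
      then show ?thesis by (simp add: lenlex_def c_def True)
    next
      case False
      with le show ?thesis by (simp add: lenlex_def c_def)
    qed
  qed
  have wf: "wf {(f, g). f \<in> B \<and> g \<in> B \<and> L f g}"
    by (rule wf_subset[OF wf_inv_image[OF wf_lenlex[OF wf_less_than], of c]]) (auto simp: code)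
  have irr: "\<not> L f f" for f by (auto simp: L_def)
  have tot: "f = g \<or> L f g \<or> L g f" if fg: "f \<in> B" "g \<in> B" for f g
  proof (cases "f = g")
    case False
    define D where "D = {x. f x \<noteq> g x}"
    have "finite D"
      by (rule finite_subset[of _ "{x. f x \<noteq> 0} \<union> {x. g x \<noteq> 0}"])
        (use fg in \<open>auto simp: D_def B_def\<close>)
    moreover have "D \<noteq> {}" using False by (auto simp: D_def)
    ultimately have "Max D \<in> D" "\<forall>y>Max D. y \<notin> D" by (simp, metis Max_ge leD)
    then show ?thesis unfolding L_def D_def
      by (metis (mono_tags, lifting) linorder_neq_iff mem_Collect_eq)
  qed simp
  have "refl_on B (\<omega>_pow s)" by (auto simp: eq refl_on_def)
  moreover have "\<omega>_pow s \<subseteq> B \<times> B" by (auto simp: eq)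
  moreover have "trans (\<omega>_pow s)" unfolding eq trans_def using Ltrans by auto
  moreover have "antisym (\<omega>_pow s)" unfolding eq antisym_def using Ltrans irr by blast
  moreover have "total_on B (\<omega>_pow s)" unfolding eq total_on_def using tot by auto
  moreover have "wf (\<omega>_pow s - Id)" by (rule wf_subset[OF wf]) (auto simp: eq)
  ultimately show ?thesis by (simp add: F order_on_defs)
qed

lemma Well_order_\<omega>_pow_natLeq: "Well_order (\<omega>_pow natLeq)"
  by (rule Well_order_\<omega>_pow_aux[of _ UNIV]) (simp add: natLeq_def)

lemma Well_order_\<omega>_pow_natLeq_on: "Well_order (\<omega>_pow (natLeq_on n))"
  by (rule Well_order_\<omega>_pow_aux[of _ "{x. x < n}"]) simp

end

theory Submission
  imports Defs "HOL-Library.Infinite_Set"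
begin

text \<open>
  Approximate a set \<open>X\<close> by deciding it on an initial segment of \<open>\<nat>\<close> and bounding its further
  elements from below in \<open>prec\<close> by an ordinal $\beta$, keeping the elements already decided above
  $\beta + \omega^j$.  While $j > 0$ such an approximation shows no least element of \<open>X\<close>, since a
  smaller one can always be added.  A $\Sigma_1(X)$-formula is false in all sets over a raised
  bound or can be made true by finitely much information; as
  $\beta + \omega^{j-1} n < \beta + \omega^j$ for every \<open>n\<close>, an induction up to \<open>n\<close> can be
  refuted at the cost of passing from $j$ to $j - 1$.

  For the height bound, every inference thus lowers $j$ by at most one, and at a leaf
  all formulas would be false in some set.  Provability with arbitrary cuts is handled without cut
  elimination: sequences of approximations with unbounded $j$ form a notion of forcing over a
  reduced power of \<open>\<nat>\<close>, weak forcing is sound for classical logic, and it forces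
  $I\Sigma_1(X)$ but not $TI(\prec)$.
\<close>

section \<open>Substitution and locality\<close>

lemma eval_subst_tm: "eval e (subst_tm \<sigma> t) = eval (\<lambda>n. eval e (\<sigma> n)) t"
  by (induction t) (simp_all add: comp_def cong: map_cong)

lemma eval_lift_tm [simp]: "eval (case_nat m e) (lift_tm t) = eval e t"
  by (simp add: lift_tm_def eval_subst_tm)

lemma eval_lift_sub: "(\<lambda>n. eval (case_nat m e) (lift_sub \<sigma> n)) = case_nat m (\<lambda>n. eval e (\<sigma> n))"
  by (auto simp: lift_sub_def fun_eq_iff split: nat.split)

lemma sat_atom_subst: "sat_atom S e (subst_atom \<sigma> a) = sat_atom S (\<lambda>n. eval e (\<sigma> n)) a"
  by (cases a) (simp_all add: eval_subst_tm comp_def)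

lemma sat_subst: "sat S e (subst_fm \<sigma> \<phi>) = sat S (\<lambda>n. eval e (\<sigma> n)) \<phi>"
  by (induction \<phi> arbitrary: e \<sigma>) (simp_all add: sat_atom_subst eval_lift_sub)

lemma eval_case_nat: "(\<lambda>n. eval e (case_nat u \<sigma> n)) = case_nat (eval e u) (\<lambda>n. eval e (\<sigma> n))"
  by (auto simp: fun_eq_iff split: nat.split)

lemma sat_inst: "sat S e (inst u \<phi>) = sat S (case_nat (eval e u) e) \<phi>"
  by (simp add: inst_def sat_subst eval_case_nat)

lemma sat_neg [simp]: "sat S e (neg \<phi>) = (\<not> sat S e \<phi>)"
  by (induction \<phi> arbitrary: e) simp_all

lemma neg_neg [simp]: "neg (neg \<phi>) = \<phi>"
  by (induction \<phi>) simp_all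

lemma eval_cong: "(\<And>n. n \<in> var_tm t \<Longrightarrow> e n = e' n) \<Longrightarrow> eval e t = eval e' t"
proof (induction t)
  case (Fn f ts)
  then have "map (eval e) ts = map (eval e') ts" by auto
  then show ?case by (simp del: map_eq_conv)
qed simp

lemma sat_atom_cong:
  assumes "\<And>n. n \<in> fv_atom a \<Longrightarrow> e n = e' n"
  shows "sat_atom S e a = sat_atom S e' a"
proof (cases a)
  case (Pred p ts)
  then have "map (eval e) ts = map (eval e') ts"
    using assms by (auto intro!: eval_cong)
  then show ?thesis by (simp add: Pred del: map_eq_conv)
next
  case (InX t)
  then have "eval e t = eval e' t" using assms by (intro eval_cong) auto
  then show ?thesis by (simp add: InX)
qed

lemma sat_cong: "(\<And>n. n \<in> fv \<phi> \<Longrightarrow> e n = e' n) \<Longrightarrow> sat S e \<phi> = sat S e' \<phi>"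
proof (induction \<phi> arbitrary: e e')
  case (All \<phi>)
  have "sat S (case_nat m e) \<phi> = sat S (case_nat m e') \<phi>" for m
    by (rule All.IH) (use All.prems in \<open>auto split: nat.split\<close>)
  then show ?case by simp
next
  case (Ex \<phi>)
  have "sat S (case_nat m e) \<phi> = sat S (case_nat m e') \<phi>" for m
    by (rule Ex.IH) (use Ex.prems in \<open>auto split: nat.split\<close>)
  then show ?case by simp
next
  case (Conj \<phi> \<psi>)
  have "sat S e \<phi> = sat S e' \<phi>" "sat S e \<psi> = sat S e' \<psi>"
    using Conj.prems by (auto intro!: Conj.IH)
  then show ?case by simp
next
  case (Disj \<phi> \<psi>)
  have "sat S e \<phi> = sat S e' \<phi>" "sat S e \<psi> = sat S e' \<psi>"
    using Disj.prems by (auto intro!: Disj.IH)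
  then show ?case by simp
qed (simp_all, (metis sat_atom_cong)+)

lemma var_tm_subst: "var_tm (subst_tm \<sigma> t) = (\<Union>n\<in>var_tm t. var_tm (\<sigma> n))"
  by (induction t) auto

lemma fv_atom_subst: "fv_atom (subst_atom \<sigma> a) = (\<Union>n\<in>fv_atom a. var_tm (\<sigma> n))"
  by (cases a) (auto simp: var_tm_subst)

lemma Suc_mem_var_tm_lift_sub:
  "Suc n \<in> var_tm (lift_sub \<sigma> m) \<longleftrightarrow> (\<exists>k. m = Suc k \<and> n \<in> var_tm (\<sigma> k))"
  by (cases m) (auto simp: lift_sub_def lift_tm_def var_tm_subst)

lemma fv_subst: "fv (subst_fm \<sigma> \<phi>) = (\<Union>n\<in>fv \<phi>. var_tm (\<sigma> n))"
  by (induction \<phi> arbitrary: \<sigma>) (auto simp: fv_atom_subst Suc_mem_var_tm_lift_sub)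

text \<open>Substitution for index 0 only renumbers the other indices. So an eigenvariable absent
  from \<open>inst zero_tm \<phi>\<close>, as the induction rule provides, is absent from \<phi>
  too.\<close>

lemma fv_inst_superset: "{n. Suc n \<in> fv \<phi>} \<subseteq> fv (inst u \<phi>)"
proof
  fix n assume "n \<in> {n. Suc n \<in> fv \<phi>}"
  then show "n \<in> fv (inst u \<phi>)"
    unfolding inst_def fv_subst by (intro UN_I[of "Suc n"]) auto
qed

lemma sat_inst_Var_fresh:
  assumes "Suc a \<notin> fv \<phi>"
  shows "sat S (case_nat m (e(a := m'))) \<phi> = sat S (case_nat m e) \<phi>"
  by (rule sat_cong) (use assms in \<open>auto split: nat.split\<close>)

lemma sat_fresh: "a \<notin> FV \<Gamma> \<Longrightarrow> \<phi> \<in> \<Gamma> \<Longrightarrow> sat S (e(a := m)) \<phi> = sat S e \<phi>"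
  by (rule sat_cong) (auto simp: FV_def)

lemma sat_atom_pred2 [simp]: "sat_atom S e (pred2 R s t) = R (eval e s) (eval e t)"
  by (simp add: pred2_def)

lemma eval_zero_tm [simp]: "eval e zero_tm = 0"
  by (simp add: zero_tm_def)

lemma eval_one_tm [simp]: "eval e one_tm = 1"
  by (simp add: one_tm_def)

lemma eval_plus_tm [simp]: "eval e (plus_tm s t) = eval e s + eval e t"
  by (simp add: plus_tm_def)

section \<open>Formulas decided by a finite part of X that depends on the assignment alone\<close>

definition local :: "fm \<Rightarrow> bool" where
  "local \<phi> \<longleftrightarrow>
     (\<forall>e. \<exists>M. \<forall>S S'. S \<inter> {..<M} = S' \<inter> {..<M} \<longrightarrow> sat S e \<phi> = sat S' e \<phi>)"

lemma localI:
  assumes "\<And>e. \<exists>M. \<forall>S S'. S \<inter> {..<M} = S' \<inter> {..<M} \<longrightarrow> sat S e \<phi> = sat S' e \<phi>"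
  shows "local \<phi>"
  using assms by (simp add: local_def)

lemma localD:
  "local \<phi> \<Longrightarrow> \<exists>M. \<forall>S S'. S \<inter> {..<M} = S' \<inter> {..<M} \<longrightarrow> sat S e \<phi> = sat S' e \<phi>"
  by (simp add: local_def)

lemma Int_lessThan_mono:
  fixes M M' :: nat
  assumes "S \<inter> {..<M'} = S' \<inter> {..<M'}" "M \<le> M'"
  shows "S \<inter> {..<M} = S' \<inter> {..<M}"
proof -
  have *: "A \<inter> {..<M} = (A \<inter> {..<M'}) \<inter> {..<M}" for A
    using assms(2) by auto
  show ?thesis by (subst (1 2) *) (simp only: assms(1))
qed

lemma local_Pos [simp]: "local (Pos a)"
proof (rule localI)
  fix e
  show "\<exists>M. \<forall>S S'. S \<inter> {..<M} = S' \<inter> {..<M} \<longrightarrow> sat S e (Pos a) = sat S' e (Pos a)"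
  proof (cases a)
    case (InX t)
    then show ?thesis
      by (intro exI[of _ "Suc (eval e t)"]) (auto simp: set_eq_iff)
  qed simp
qed

lemma local_neg [simp]: "local (neg \<phi>) = local \<phi>"
  by (simp add: local_def)

lemma local_Neg [simp]: "local (Neg a)"
  using local_neg[of "Pos a"] by simp

lemma local_Conj: assumes "local \<phi>" "local \<psi>" shows "local (Conj \<phi> \<psi>)"
proof (rule localI)
  fix e
  obtain M where M [rule_format]: "\<forall>S S'. S \<inter> {..<M} = S' \<inter> {..<M} \<longrightarrow> sat S e \<phi> = sat S' e \<phi>"
    using localD[OF assms(1), where e = e] by (rule exE)
  obtain M' where M' [rule_format]: "\<forall>S S'. S \<inter> {..<M'} = S' \<inter> {..<M'} \<longrightarrow> sat S e \<psi> = sat S' e \<psi>"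
    using localD[OF assms(2), where e = e] by (rule exE)
  show "\<exists>M. \<forall>S S'. S \<inter> {..<M} = S' \<inter> {..<M} \<longrightarrow>
      sat S e (Conj \<phi> \<psi>) = sat S' e (Conj \<phi> \<psi>)"
  proof (intro exI[of _ "max M M'"] allI impI)
    fix S S' assume eq: "S \<inter> {..<max M M'} = S' \<inter> {..<max M M'}"
    show "sat S e (Conj \<phi> \<psi>) = sat S' e (Conj \<phi> \<psi>)"
      using M[OF Int_lessThan_mono[OF eq]] M'[OF Int_lessThan_mono[OF eq]] by simp
  qed
qed

lemma local_Disj: assumes "local \<phi>" "local \<psi>" shows "local (Disj \<phi> \<psi>)"
  unfolding local_neg[of "Disj \<phi> \<psi>", symmetric]
  using local_Conj[of "neg \<phi>" "neg \<psi>"] assms by simp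

text \<open>Only the instances up to the value of \<open>t\<close> matter, and the largest of their
  finitely many moduli serves for all of them.\<close>

lemma local_bounded_All:
  assumes "local \<phi>"
  shows "local (All (Disj (Neg (pred2 (\<le>) (Var 0) (lift_tm t))) \<phi>))"
proof (rule localI)
  fix e
  have "\<exists>M. \<forall>S S'. S \<inter> {..<M} = S' \<inter> {..<M} \<longrightarrow>
      sat S (case_nat n e) \<phi> = sat S' (case_nat n e) \<phi>" for n
    using localD[OF assms] .
  then obtain M where M: "\<And>n S S'. S \<inter> {..<M n} = S' \<inter> {..<M n} \<Longrightarrow>
      sat S (case_nat n e) \<phi> = sat S' (case_nat n e) \<phi>"
    by metis
  define K where "K = Max (M ` {..eval e t})"
  have K: "M n \<le> K" if "n \<le> eval e t" for n
    unfolding K_def by (rule Max_ge) (use that in auto)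
  show "\<exists>M. \<forall>S S'. S \<inter> {..<M} = S' \<inter> {..<M} \<longrightarrow>
      sat S e (All (Disj (Neg (pred2 (\<le>) (Var 0) (lift_tm t))) \<phi>)) =
      sat S' e (All (Disj (Neg (pred2 (\<le>) (Var 0) (lift_tm t))) \<phi>))"
  proof (intro exI[of _ K] allI impI)
    fix S S' assume "S \<inter> {..<K} = S' \<inter> {..<K}"
    then have "sat S (case_nat n e) \<phi> = sat S' (case_nat n e) \<phi>" if "n \<le> eval e t" for n
      using M K that Int_lessThan_mono by metis
    then show "sat S e (All (Disj (Neg (pred2 (\<le>) (Var 0) (lift_tm t))) \<phi>)) =
      sat S' e (All (Disj (Neg (pred2 (\<le>) (Var 0) (lift_tm t))) \<phi>))"
      by auto
  qed
qed

lemma local_bounded_Ex: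
  assumes "local \<phi>"
  shows "local (Ex (Conj (Pos (pred2 (\<le>) (Var 0) (lift_tm t))) \<phi>))"
  unfolding local_neg[of "Ex (Conj (Pos (pred2 (\<le>) (Var 0) (lift_tm t))) \<phi>)", symmetric]
  using local_bounded_All[of "neg \<phi>" t] assms by simp

lemma local_subst: "local \<phi> \<Longrightarrow> local (subst_fm \<sigma> \<phi>)"
  by (simp add: local_def sat_subst)

lemma sat_atom_X_free: "\<forall>t. a \<noteq> InX t \<Longrightarrow> sat_atom S e a = sat_atom S' e a"
  by (cases a) auto

lemma sat_X_free: "X_free \<phi> \<Longrightarrow> sat S e \<phi> = sat S' e \<phi>"
  by (induction \<phi> arbitrary: e) (auto simp: sat_atom_X_free[of _ S _ S'])

lemma local_X_free: "X_free \<phi> \<Longrightarrow> local \<phi>"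
  unfolding local_def using sat_X_free by blast

text \<open>
  Every formula of a derivation of \<open>TI prec\<close> with cuts and inductions on $p\Sigma_1(X)$-formulas,
  except the conclusion of \<open>TI prec\<close> itself, is tame.  Locality is required of the immediate
  subformulas only.
\<close>

primrec tame :: "fm \<Rightarrow> bool" where
  "tame (Pos a) \<longleftrightarrow> True"
| "tame (Neg a) \<longleftrightarrow> True"
| "tame (Conj \<phi> \<psi>) \<longleftrightarrow> tame \<phi> \<and> tame \<psi> \<and> local \<phi>"
| "tame (Disj \<phi> \<psi>) \<longleftrightarrow> tame \<phi> \<and> tame \<psi> \<and> local \<phi>"
| "tame (All \<phi>) \<longleftrightarrow> tame \<phi> \<and> local \<phi>"
| "tame (Ex \<phi>) \<longleftrightarrow> tame \<phi> \<and> local \<phi>"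

lemma tame_neg [simp]: "tame (neg \<phi>) = tame \<phi>"
  by (induction \<phi>) auto

lemma tame_subst: "tame \<phi> \<Longrightarrow> tame (subst_fm \<sigma> \<phi>)"
  by (induction \<phi> arbitrary: \<sigma>) (auto intro: local_subst)

lemma tame_inst: "tame \<phi> \<Longrightarrow> tame (inst u \<phi>)"
  by (simp add: inst_def tame_subst)

text \<open>Sentences of \<open>ThN\<close> may have any quantifier complexity, but without X a
  formula is local because its truth is the same in all sets.\<close>

lemma tame_X_free: "X_free \<phi> \<Longrightarrow> tame \<phi>"
  by (induction \<phi>) (auto intro: local_X_free)

lemma Delta0X_tame_local: "\<phi> \<in> Delta0X \<Longrightarrow> tame \<phi> \<and> local \<phi>"
  by (induction rule: Delta0X.induct)
    (auto intro: local_Conj local_Disj local_bounded_All local_bounded_Ex)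

lemma pSigmaX_1_cases:
  assumes "\<phi> \<in> pSigmaX 1"
  obtains \<psi> where "\<phi> = Ex \<psi>" "tame \<psi>" "local \<psi>"
  using assms Delta0X_tame_local by auto

text \<open>A witness is certified by a finite part of \<open>S\<close>, so truth is an open
  property of the set. Here the bound depends on \<open>S\<close>, and falsity need not be certified
  by any finite part.\<close>

lemma Ex_local_open:
  assumes "local \<psi>" "sat S e (Ex \<psi>)"
  obtains M where "\<And>S'. S' \<inter> {..<M} = S \<inter> {..<M} \<Longrightarrow> sat S' e (Ex \<psi>)"
proof -
  obtain n where n: "sat S (case_nat n e) \<psi>" using assms(2) by auto
  obtain M where M [rule_format]: "\<forall>S S'. S \<inter> {..<M} = S' \<inter> {..<M} \<longrightarrow>
      sat S (case_nat n e) \<psi> = sat S' (case_nat n e) \<psi>"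
    using localD[OF assms(1), where e = "case_nat n e"] by (rule exE)
  with n that show ?thesis by (metis sat.simps(6))
qed

section \<open>The conclusion of \<open>TI prec\<close> and its matrix\<close>

definition TI_matrix :: "(nat \<Rightarrow> nat \<Rightarrow> bool) \<Rightarrow> fm" where
  "TI_matrix prec =
     Conj (Pos (InX (Var 1))) (Disj (Neg (InX (Var 0))) (Neg (pred2 prec (Var 0) (Var 1))))"

lemma TI_concl_eq: "TI_concl prec = Ex (All (TI_matrix prec))"
  by (simp add: TI_concl_def TI_matrix_def)

text \<open>Locality may be lost once the matrix is quantified universally, so tameness is claimed
  for the matrix and not for \<open>TI_concl prec\<close>.\<close>

lemma tame_TI_matrix: "tame (TI_matrix prec)" and local_TI_matrix: "local (TI_matrix prec)"
  by (auto simp: TI_matrix_def intro!: local_Conj local_Disj)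

lemma sat_TI_matrix: "sat S (case_nat m (case_nat n e)) (TI_matrix prec) \<longleftrightarrow>
    n \<in> S \<and> (m \<in> S \<longrightarrow> \<not> prec m n)"
  by (auto simp: TI_matrix_def)

section \<open>Approximations of a set without least element\<close>

text \<open>\<open>emb\<close> sends Cantor normal forms, sums of \<omega>^i f(i), monotonically
  into \<open>prec\<close>. The exponents \<open>H\<close> are those up to h for the height bound
  and all numbers for unprovability.\<close>

locale omega_embedding =
  fixes prec :: "nat \<Rightarrow> nat \<Rightarrow> bool" and H :: "nat set" and emb :: "(nat \<Rightarrow> nat) \<Rightarrow> nat"
  assumes irrefl: "\<not> prec x x"
    and trans: "prec x y \<Longrightarrow> prec y z \<Longrightarrow> prec x z"
    and H_down: "Suc j \<in> H \<Longrightarrow> j \<in> H"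
    and emb_mono: "finite {x. f x \<noteq> 0} \<Longrightarrow> finite {x. g x \<noteq> 0} \<Longrightarrow>
      {x. f x \<noteq> 0} \<subseteq> H \<Longrightarrow> {x. g x \<noteq> 0} \<subseteq> H \<Longrightarrow>
      f z < g z \<Longrightarrow> (\<And>y. y > z \<Longrightarrow> f y = g y) \<Longrightarrow> prec (emb f) (emb g)"
begin

definition le :: "nat \<Rightarrow> nat \<Rightarrow> bool" where
  "le x y \<longleftrightarrow> x = y \<or> prec x y"

lemma le_refl [simp]: "le x x"
  by (simp add: le_def)

lemma le_trans: "le x y \<Longrightarrow> le y z \<Longrightarrow> le x z"
  using trans by (auto simp: le_def)

lemma prec_le_trans: "prec x y \<Longrightarrow> le y z \<Longrightarrow> prec x z"
  using trans by (auto simp: le_def)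

text \<open>With no exponents below \<open>j\<close>, raising the coefficient at \<open>j\<close> is
  exactly the addition of \<omega>^j. Requiring \<open>j \<in> H\<close> keeps that sum in the
  domain of \<open>emb\<close>.\<close>

definition multiple :: "nat \<Rightarrow> (nat \<Rightarrow> nat) \<Rightarrow> bool" where
  "multiple j \<beta> \<longleftrightarrow> j \<in> H \<and> finite {x. \<beta> x \<noteq> 0} \<and> {x. \<beta> x \<noteq> 0} \<subseteq> H \<inter> {j..}"

definition cone :: "nat \<Rightarrow> nat set \<Rightarrow> (nat \<Rightarrow> nat) \<Rightarrow> nat set set" where
  "cone N F \<beta> = {S. S \<inter> {..<N} = F \<and> (\<forall>x\<in>S. le (emb \<beta>) x)}"

text \<open>
  \<open>\<beta>\<close> codes the ordinal $\beta = \sum_{i \ge j} \omega^i \beta_i$, so that \<open>\<beta>(j := Suc (\<beta> j))\<close> is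
  $\beta + \omega^j$: the elements decided so far leave room for a factor $\omega^j$ above the
  bound that all further elements obey.
\<close>

definition good :: "nat \<Rightarrow> nat set set \<Rightarrow> bool" where
  "good j C \<longleftrightarrow> (\<exists>N F \<beta>. C = cone N F \<beta> \<and> F \<subseteq> {..<N} \<and> multiple j \<beta> \<and>
     (\<forall>x\<in>F. le (emb (\<beta>(j := Suc (\<beta> j)))) x))"

lemma goodI:
  assumes "F \<subseteq> {..<N}" "multiple j \<beta>" "\<And>x. x \<in> F \<Longrightarrow> le (emb (\<beta>(j := Suc (\<beta> j)))) x"
  shows "good j (cone N F \<beta>)"
  using assms unfolding good_def by blast

lemma goodE:
  assumes "good j C"
  obtains N F \<beta> where "C = cone N F \<beta>" "F \<subseteq> {..<N}" "multiple j \<beta>"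
    "\<And>x. x \<in> F \<Longrightarrow> le (emb (\<beta>(j := Suc (\<beta> j)))) x"
  using assms unfolding good_def by blast

lemma multiple_upd: "multiple j \<beta> \<Longrightarrow> multiple j (\<beta>(j := c))"
proof -
  assume *: "multiple j \<beta>"
  have "{x. (\<beta>(j := c)) x \<noteq> 0} \<subseteq> insert j {x. \<beta> x \<noteq> 0}" by auto
  with * show ?thesis
    unfolding multiple_def by (blast intro: finite_subset)
qed

lemma multiple_Suc: "multiple (Suc j) \<beta> \<Longrightarrow> multiple j \<beta>"
  unfolding multiple_def using H_down by auto

lemma emb_less:
  assumes "multiple j f" "multiple k g" "f z < g z" "\<And>y. y > z \<Longrightarrow> f y = g y"
  shows "prec (emb f) (emb g)"
  using assms by (intro emb_mono[of f g z]) (auto simp: multiple_def)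

lemma emb_upd_less:
  assumes "multiple j \<beta>" "c < c'"
  shows "prec (emb (\<beta>(j := c))) (emb (\<beta>(j := c')))"
  by (rule emb_less[of j _ j _ j]) (use assms multiple_upd in auto)

lemma le_emb_upd:
  assumes "multiple j \<beta>" "\<beta> j \<le> c"
  shows "le (emb \<beta>) (emb (\<beta>(j := c)))"
  using emb_upd_less[OF assms(1), of "\<beta> j" c] assms(2) by (auto simp: le_def le_less)

text \<open>From the top, the codes first differ at exponent \<open>Suc j\<close>, so \<beta> +
  \<omega>^j c < \<beta> + \<omega>^(j+1) for every c. This is the room in which inductions of any
  length are refuted.\<close>

lemma emb_upd_less_Suc:
  assumes "multiple (Suc j) \<beta>"
  shows "prec (emb (\<beta>(j := c))) (emb (\<beta>(Suc j := Suc (\<beta> (Suc j)))))"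
  by (rule emb_less[of j _ "Suc j" _ "Suc j"])
    (use assms multiple_upd[OF multiple_Suc] multiple_upd in auto)

lemma multiple_Suc_zero: "multiple (Suc j) \<beta> \<Longrightarrow> \<beta> j = 0"
  unfolding multiple_def by force

text \<open>Adding no further element is always allowed: the elements of \<open>F\<close> lie above
  \<beta> + \<omega>^j and so respect the bound \<beta>.\<close>

lemma good_base_mem:
  assumes "F \<subseteq> {..<N}" "multiple j \<beta>" "\<And>x. x \<in> F \<Longrightarrow> le (emb (\<beta>(j := Suc (\<beta> j)))) x" "N \<le> M"
  shows "F \<in> cone M F \<beta>"
proof -
  have "le (emb \<beta>) x" if "x \<in> F" for x
    using le_trans[OF le_emb_upd[OF assms(2)] assms(3)[OF that]] by simp
  moreover have "F \<inter> {..<M} = F" using assms(1,4) by (auto)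
  ultimately show ?thesis by (auto simp: cone_def)
qed

lemma cone_mono:
  assumes "N \<le> M" "F' \<inter> {..<N} = F"
  shows "cone M F' \<beta> \<subseteq> cone N F \<beta>"
proof
  fix S assume S: "S \<in> cone M F' \<beta>"
  have "S \<inter> {..<N} = S \<inter> {..<M} \<inter> {..<N}" using assms(1) by auto
  with S assms(2) show "S \<in> cone N F \<beta>" by (simp add: cone_def)
qed

lemma good_nonempty: "good j C \<Longrightarrow> C \<noteq> {}"
  by (elim goodE) (use good_base_mem in blast)

lemma good_pred: "good (Suc j) C \<Longrightarrow> good j C"
proof (elim goodE)
  fix N F \<beta>
  assume *: "C = cone N F \<beta>" "F \<subseteq> {..<N}" "multiple (Suc j) \<beta>"
    "\<And>x. x \<in> F \<Longrightarrow> le (emb (\<beta>(Suc j := Suc (\<beta> (Suc j))))) x"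
  show "good j C"
    unfolding \<open>C = _\<close>
    by (rule goodI)
      (use * multiple_Suc prec_le_trans[OF emb_upd_less_Suc[OF *(3)] *(4)] in \<open>auto simp: le_def\<close>)
qed

lemma good_antimono: "j \<le> k \<Longrightarrow> good k C \<Longrightarrow> good j C"
  by (induction k rule: dec_induct) (blast dest: good_pred)+

text \<open>With bound 0, deciding \<omega>^j as the only member so far leaves room exactly
  \<omega>^j. The guaranteed member is what makes \<open>TI_hyp\<close> false.\<close>

lemma good_start: "j \<in> H \<Longrightarrow> \<exists>m C. good j C \<and> (\<forall>S\<in>C. m \<in> S)"
proof -
  assume "j \<in> H"
  define m where "m = emb ((\<lambda>_. 0)(j := Suc 0))"
  have "good j (cone (Suc m) {m} (\<lambda>_. 0))"
    by (rule goodI) (use \<open>j \<in> H\<close> in \<open>auto simp: multiple_def m_def\<close>)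
  moreover have "\<forall>S\<in>cone (Suc m) {m} (\<lambda>_. 0). m \<in> S" by (auto simp: cone_def)
  ultimately show ?thesis by (intro exI conjI)
qed

text \<open>Deciding that no new element lies below \<open>M\<close> leaves \<open>F\<close>, and
  hence the room, unchanged, while all sets of the new cone agree below \<open>M\<close>.\<close>

lemma good_commit:
  assumes "good j C"
    and M: "\<forall>S S'. S \<inter> {..<M} = S' \<inter> {..<M} \<longrightarrow> \<Phi> S = \<Phi> S'"
  shows "\<exists>C'\<subseteq>C. good j C' \<and> (\<forall>S\<in>C'. \<forall>S'\<in>C'. \<Phi> S = \<Phi> S')"
proof -
  obtain N F \<beta> where *: "C = cone N F \<beta>" "F \<subseteq> {..<N}" "multiple j \<beta>"
    "\<And>x. x \<in> F \<Longrightarrow> le (emb (\<beta>(j := Suc (\<beta> j)))) x"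
    using goodE[OF assms(1)] by metis
  let ?C = "cone (max N M) F \<beta>"
  have "?C \<subseteq> C" unfolding *(1) by (rule cone_mono) (use *(2) in auto)
  moreover have "good j ?C" by (rule goodI) (use * in auto)
  moreover have "\<Phi> S = \<Phi> S'" if "S \<in> ?C" "S' \<in> ?C" for S S'
    by (rule M[rule_format, OF Int_lessThan_mono[of _ "max N M"]])
      (use that in \<open>simp_all add: cone_def\<close>)
  ultimately show ?thesis by (intro exI[of _ ?C] conjI ballI)
qed

lemma good_decide:
  assumes "good j C" "local \<phi>"
  obtains C' where "C' \<subseteq> C" "good j C'" "(\<forall>S\<in>C'. sat S e \<phi>) \<or> (\<forall>S\<in>C'. \<not> sat S e \<phi>)"
proof -
  obtain M where M: "\<forall>S S'. S \<inter> {..<M} = S' \<inter> {..<M} \<longrightarrow> sat S e \<phi> = sat S' e \<phi>"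
    using localD[OF assms(2), where e = e] by (rule exE)
  obtain C' where C': "C' \<subseteq> C" "good j C'" "\<forall>S\<in>C'. \<forall>S'\<in>C'. sat S e \<phi> = sat S' e \<phi>"
    using good_commit[of j C M "\<lambda>S. sat S e \<phi>", OF assms(1) M] by (elim exE conjE)
  then have "(\<forall>S\<in>C'. sat S e \<phi>) \<or> (\<forall>S\<in>C'. \<not> sat S e \<phi>)" by blast
  then show ?thesis by (rule that[OF C'(1,2)])
qed

text \<open>The set \<open>F\<close> itself lies in the cone and supplies \<open>n\<close>.
  Excluding all other numbers on which this instance depends makes the same \<open>n\<close> work
  throughout, without loss of room.\<close>

lemma good_witness:
  assumes "good j C" "local \<phi>" "\<And>S. S \<in> C \<Longrightarrow> \<exists>n. sat S (case_nat n e) \<phi>"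
  shows "\<exists>n. \<exists>C'\<subseteq>C. good j C' \<and> (\<forall>S\<in>C'. sat S (case_nat n e) \<phi>)"
proof -
  obtain N F \<beta> where *: "C = cone N F \<beta>" "F \<subseteq> {..<N}" "multiple j \<beta>"
    "\<And>x. x \<in> F \<Longrightarrow> le (emb (\<beta>(j := Suc (\<beta> j)))) x"
    using goodE[OF assms(1)] by metis
  have "F \<in> C" unfolding *(1) using good_base_mem[OF *(2-4) order_refl] .
  then obtain n where n: "sat F (case_nat n e) \<phi>" using assms(3) by blast
  obtain M where M [rule_format]: "\<forall>S S'. S \<inter> {..<M} = S' \<inter> {..<M} \<longrightarrow>
      sat S (case_nat n e) \<phi> = sat S' (case_nat n e) \<phi>"
    using localD[OF assms(2), where e = "case_nat n e"] by (rule exE)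
  let ?C = "cone (max N M) F \<beta>"
  have "?C \<subseteq> C" unfolding *(1) by (rule cone_mono) (use *(2) in auto)
  moreover have "good j ?C" by (rule goodI) (use * in auto)
  moreover have "sat S (case_nat n e) \<phi>" if "S \<in> ?C" for S
  proof -
    have "S \<inter> {..<max N M} = F \<inter> {..<max N M}" using that *(2) by (auto simp: cone_def)
    then have "S \<inter> {..<M} = F \<inter> {..<M}" by (rule Int_lessThan_mono) simp
    from M[OF this] n show ?thesis by simp
  qed
  ultimately show ?thesis by (intro exI[of _ n] exI[of _ ?C]) simp
qed

text \<open>
  Either \<open>\<Phi>\<close> fails throughout the cone over the raised bound, or a set in that cone satisfies
  \<open>\<Phi>\<close>; deciding enough of it makes \<open>\<Phi>\<close> permanent, at the cost of one unit $\omega^j$ of room.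
\<close>

lemma cone_dichotomy:
  assumes F: "F \<subseteq> {..<N}" "\<And>x. x \<in> F \<Longrightarrow> le (emb (\<beta>(j := Suc c))) x"
    and \<beta>: "multiple (Suc j) \<beta>"
    and op: "\<And>S. \<Phi> S \<Longrightarrow> \<exists>M. \<forall>S'. S' \<inter> {..<M} = S \<inter> {..<M} \<longrightarrow> \<Phi> S'"
  shows "(\<exists>C'\<subseteq>cone N F \<beta>. good j C' \<and> (\<forall>S\<in>C'. \<not> \<Phi> S)) \<or>
    (\<exists>N' F'. F' \<subseteq> {..<N'} \<and> cone N' F' \<beta> \<subseteq> cone N F \<beta> \<and>
       (\<forall>x\<in>F'. le (emb (\<beta>(j := c))) x) \<and> (\<forall>S\<in>cone N' F' \<beta>. \<Phi> S))"
proof (cases "\<forall>S\<in>cone N F (\<beta>(j := c)). \<not> \<Phi> S")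
  case True
  have "le (emb \<beta>) (emb (\<beta>(j := c)))"
    using le_emb_upd[OF multiple_Suc[OF \<beta>]] multiple_Suc_zero[OF \<beta>] by simp
  then have "cone N F (\<beta>(j := c)) \<subseteq> cone N F \<beta>" by (auto simp: cone_def intro: le_trans)
  \<comment> \<open>Room \<omega>^j remains over the raised bound \<beta> + \<omega>^j c, since
    \<open>F\<close> lies above \<beta> + \<omega>^j (c+1).\<close>
  moreover have "good j (cone N F (\<beta>(j := c)))"
    by (rule goodI) (use F multiple_upd[OF multiple_Suc[OF \<beta>]] in auto)
  ultimately show ?thesis using True by blast
next
  case False
  then obtain S where S: "S \<in> cone N F (\<beta>(j := c))" "\<Phi> S" by blast
  obtain M where M: "\<And>S'. S' \<inter> {..<M} = S \<inter> {..<M} \<Longrightarrow> \<Phi> S'" using op[OF S(2)] by blast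
  \<comment> \<open>The raised bound serves only to choose \<open>S\<close>. The new cone returns to
    the bound \<beta>, and the elements of \<open>S\<close> decided now lie above \<beta> +
    \<omega>^j c.\<close>
  let ?N = "max N M" and ?F = "S \<inter> {..<max N M}"
  have "?F \<subseteq> {..<?N}" by simp
  moreover have "cone ?N ?F \<beta> \<subseteq> cone N F \<beta>"
    by (rule cone_mono) (use S(1) in \<open>auto simp: cone_def\<close>)
  moreover have "\<forall>x\<in>?F. le (emb (\<beta>(j := c))) x" using S(1) by (auto simp: cone_def)
  moreover have "\<forall>S'\<in>cone ?N ?F \<beta>. \<Phi> S'"
    by (intro ballI M Int_lessThan_mono[of _ ?N _ M]) (auto simp: cone_def)
  ultimately show ?thesis by (intro disjI2 exI[of _ ?N] exI[of _ ?F] conjI)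
qed

text \<open>Room \<omega>^(j+1) contains n + 2 units \<omega>^j, enough to apply the dichotomy to
  \<Phi> 0, ..., \<Phi> n in turn. The first negative answer refutes the base or a step; if there is
  none, \<Phi> n has become permanent.\<close>

lemma good_induction:
  assumes "good (Suc j) C"
    and op: "\<And>i S. \<Phi> i S \<Longrightarrow> \<exists>M. \<forall>S'. S' \<inter> {..<M} = S \<inter> {..<M} \<longrightarrow> \<Phi> i S'"
  shows "\<exists>m. \<exists>C'\<subseteq>C. good j C' \<and>
    ((\<forall>S\<in>C'. \<not> \<Phi> 0 S) \<or> (\<forall>S\<in>C'. \<Phi> m S \<and> \<not> \<Phi> (Suc m) S) \<or> (\<forall>S\<in>C'. \<Phi> n S))"
    (is ?goal)
proof (rule ccontr)
  assume "\<not> ?goal"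
  then have no: "\<not> ((\<forall>S\<in>C'. \<not> \<Phi> 0 S) \<or> (\<forall>S\<in>C'. \<Phi> m S \<and> \<not> \<Phi> (Suc m) S) \<or> (\<forall>S\<in>C'. \<Phi> n S))"
    if "C' \<subseteq> C" "good j C'" for m C'
    using that by blast
  obtain N F \<beta> where *: "C = cone N F \<beta>" "F \<subseteq> {..<N}" "multiple (Suc j) \<beta>"
    "\<And>x. x \<in> F \<Longrightarrow> le (emb (\<beta>(Suc j := Suc (\<beta> (Suc j))))) x"
    using goodE[OF assms(1)] by metis
  \<comment> \<open>Stage i leaves n - i + 1 units: one for each dichotomy still to come, and one
    that is the final room.\<close>
  have reach: "i \<le> n \<Longrightarrow> \<exists>N' F'. F' \<subseteq> {..<N'} \<and> cone N' F' \<beta> \<subseteq> C \<and>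
       (\<forall>x\<in>F'. le (emb (\<beta>(j := Suc (n - i)))) x) \<and> (\<forall>S\<in>cone N' F' \<beta>. \<Phi> i S)" for i
  proof (induction i)
    case 0
    have "le (emb (\<beta>(j := Suc (Suc n)))) x" if "x \<in> F" for x
      using prec_le_trans[OF emb_upd_less_Suc[OF *(3)] *(4)[OF that]] by (simp add: le_def)
    note cone_dichotomy[of F N \<beta> j "Suc n" "\<Phi> 0", OF *(2) this *(3) op]
    then show ?case
    proof
      assume "\<exists>C'\<subseteq>cone N F \<beta>. good j C' \<and> (\<forall>S\<in>C'. \<not> \<Phi> 0 S)"
      then obtain C' where C': "C' \<subseteq> C" "good j C'" "\<forall>S\<in>C'. \<not> \<Phi> 0 S"
        unfolding *(1) by (elim exE conjE)
      from notE[OF no[OF C'(1,2)] disjI1[OF C'(3)]] show ?thesis .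
    next
      assume "\<exists>N' F'. F' \<subseteq> {..<N'} \<and> cone N' F' \<beta> \<subseteq> cone N F \<beta> \<and>
        (\<forall>x\<in>F'. le (emb (\<beta>(j := Suc n))) x) \<and> (\<forall>S\<in>cone N' F' \<beta>. \<Phi> 0 S)"
      then show ?thesis unfolding *(1) diff_zero .
    qed
  next
    case (Suc i)
    have "\<exists>N' F'. F' \<subseteq> {..<N'} \<and> cone N' F' \<beta> \<subseteq> C \<and>
       (\<forall>x\<in>F'. le (emb (\<beta>(j := Suc (n - i)))) x) \<and> (\<forall>S\<in>cone N' F' \<beta>. \<Phi> i S)"
      using Suc.IH[OF Suc_leD[OF Suc.prems]] .
    then obtain N' F' where IH: "F' \<subseteq> {..<N'}" "cone N' F' \<beta> \<subseteq> C"
       "\<forall>x\<in>F'. le (emb (\<beta>(j := Suc (n - i)))) x" "\<forall>S\<in>cone N' F' \<beta>. \<Phi> i S"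
      by (elim exE conjE)
    have "Suc (n - Suc i) = n - i" using Suc.prems by simp
    note * = cone_dichotomy[of F' N' \<beta> j "n - i" "\<Phi> (Suc i)", OF IH(1) bspec[OF IH(3)] *(3) op]
    then show ?case
    proof
      assume "\<exists>C'\<subseteq>cone N' F' \<beta>. good j C' \<and> (\<forall>S\<in>C'. \<not> \<Phi> (Suc i) S)"
      then obtain C' where C': "C' \<subseteq> cone N' F' \<beta>" "good j C'" "\<forall>S\<in>C'. \<not> \<Phi> (Suc i) S"
        by (elim exE conjE)
      have "\<forall>S\<in>C'. \<Phi> i S" using C'(1) IH(4) by (auto dest!: subsetD)
      with C'(3) have "\<forall>S\<in>C'. \<Phi> i S \<and> \<not> \<Phi> (Suc i) S" by simp
      from notE[OF no[OF subset_trans[OF C'(1) IH(2)] C'(2)] disjI2[OF disjI1[OF this]]]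
      show ?thesis .
    next
      assume "\<exists>N'' F''. F'' \<subseteq> {..<N''} \<and> cone N'' F'' \<beta> \<subseteq> cone N' F' \<beta> \<and>
        (\<forall>x\<in>F''. le (emb (\<beta>(j := n - i))) x) \<and> (\<forall>S\<in>cone N'' F'' \<beta>. \<Phi> (Suc i) S)"
      then obtain N'' F'' where "F'' \<subseteq> {..<N''}" "cone N'' F'' \<beta> \<subseteq> cone N' F' \<beta>"
        "\<forall>x\<in>F''. le (emb (\<beta>(j := n - i))) x" "\<forall>S\<in>cone N'' F'' \<beta>. \<Phi> (Suc i) S"
        by (elim exE conjE)
      then show ?thesis
        unfolding \<open>Suc (n - Suc i) = n - i\<close>
        by (intro exI[of _ N''] exI[of _ F''] conjI subset_trans[OF _ IH(2)])
    qed
  qed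
  obtain N' F' where F': "F' \<subseteq> {..<N'}" "cone N' F' \<beta> \<subseteq> C"
    "\<forall>x\<in>F'. le (emb (\<beta>(j := Suc 0))) x" "\<forall>S\<in>cone N' F' \<beta>. \<Phi> n S"
    using reach[OF order_refl] unfolding diff_self_eq_0 by (elim exE conjE)
  have "good j (cone N' F' \<beta>)"
    by (rule goodI) (use F' multiple_Suc[OF *(3)] multiple_Suc_zero[OF *(3)] in auto)
  from notE[OF no[OF F'(2) this] disjI2[OF disjI2[OF F'(4)]]] show False .
qed

text \<open>If \<open>n\<close> is a decided member, it lies above \<beta> + \<omega>^(j+1), and an
  undecided number \<beta> + \<omega>^j (c+1) below it can be added. Otherwise \<open>n\<close> is
  excluded by extending the decided segment.\<close>

lemma good_descend:
  assumes "good (Suc j) C"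
  shows "\<exists>m. \<exists>C'\<subseteq>C. good j C' \<and> (\<forall>S\<in>C'. n \<in> S \<longrightarrow> m \<in> S \<and> prec m n)"
proof -
  obtain N F \<beta> where *: "C = cone N F \<beta>" "F \<subseteq> {..<N}" "multiple (Suc j) \<beta>"
    "\<And>x. x \<in> F \<Longrightarrow> le (emb (\<beta>(Suc j := Suc (\<beta> (Suc j))))) x"
    using goodE[OF assms] by metis
  note j = multiple_Suc[OF *(3)] and j0 = multiple_Suc_zero[OF *(3)]
  have less: "prec (emb (\<beta>(j := c))) x" if "x \<in> F" for c x
    using prec_le_trans[OF emb_upd_less_Suc[OF *(3)] *(4)[OF that]] .
  show ?thesis
  proof (cases "n \<in> F")
    case True
    \<comment> \<open>Only numbers below \<open>N\<close> are decided, and infinitely many numbers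
      code some \<beta> + \<omega>^j (c+1), so one of them is still free.\<close>
    have "inj (\<lambda>c. emb (\<beta>(j := Suc c)))"
      by (rule linorder_injI) (metis emb_upd_less[OF j] Suc_less_eq irrefl)
    then have "infinite (range (\<lambda>c. emb (\<beta>(j := Suc c))))"
      using finite_imageD infinite_UNIV_nat by blast
    then obtain c where c: "N \<le> emb (\<beta>(j := Suc c))"
      using infinite_nat_iff_unbounded_le[of "range (\<lambda>c. emb (\<beta>(j := Suc c)))"] by auto
    define m where "m = emb (\<beta>(j := Suc c))"
    let ?C = "cone (Suc m) (insert m F) \<beta>"
    have "?C \<subseteq> C" unfolding *(1)
      by (rule cone_mono) (use *(2) c in \<open>auto simp: m_def\<close>)
    moreover have "good j ?C"
    proof (rule goodI)
      show "insert m F \<subseteq> {..<Suc m}" using *(2) c by (auto simp: m_def)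
      have "le (emb (\<beta>(j := Suc 0))) m"
        using emb_upd_less[OF j, of "Suc 0" "Suc c"] by (cases c) (auto simp: m_def le_def)
      then show "le (emb (\<beta>(j := Suc (\<beta> j)))) x" if "x \<in> insert m F" for x
        using that less by (auto simp: j0 le_def)
    qed (rule j)
    moreover have "m \<in> S" if "S \<in> ?C" for S using that by (auto simp: cone_def)
    moreover have "prec m n" using less[OF True] by (simp add: m_def)
    ultimately show ?thesis by (intro exI[of _ m] exI[of _ ?C]) simp
  next
    case False
    let ?C = "cone (max N (Suc n)) F \<beta>"
    have "?C \<subseteq> C" unfolding *(1) by (rule cone_mono) (use *(2) in auto)
    moreover have "good j ?C"
      by (rule goodI) (use *(2) less j in \<open>auto simp: le_def\<close>)
    moreover have "n \<notin> S" if "S \<in> ?C" for S using that False by (auto simp: cone_def)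
    ultimately show ?thesis by (intro exI[of _ n] exI[of _ ?C]) simp
  qed
qed

end

section \<open>Derivations of bounded height\<close>

text \<open>Derivability with height at most \<open>j\<close>; the tree is replaced by recursion on
  the height, and height 0 leaves only initial sequents.\<close>

primrec deriv :: "nat \<Rightarrow> fm set \<Rightarrow> bool" where
  "deriv 0 \<Gamma> \<longleftrightarrow> rule_inst 1 [] \<Gamma>"
| "deriv (Suc j) \<Gamma> \<longleftrightarrow> (\<exists>Ps. rule_inst 1 Ps \<Gamma> \<and> (\<forall>\<Delta>\<in>set Ps. deriv j \<Delta>))"

lemma derivation_imp_deriv:
  assumes "derivation 1 \<tau> lab \<Gamma>" "height \<tau> \<le> h"
  shows "deriv h \<Gamma>"
proof -
  have fin: "finite \<tau>" and tree: "rooted_tree \<tau>" and root: "lab [] = \<Gamma>"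
    and step: "\<And>v. v \<in> \<tau> \<Longrightarrow> \<exists>ks. distinct ks \<and> set ks = {k. v @ [k] \<in> \<tau>} \<and>
        rule_inst 1 (map (\<lambda>k. lab (v @ [k])) ks) (lab v)"
    using assms(1) by (auto simp: derivation_def)
  have len: "length v \<le> h" if "v \<in> \<tau>" for v
    using assms(2) fin that by (auto simp: height_def intro: order_trans[OF Max_ge])
  \<comment> \<open>Here \<open>j\<close> is the height still available above the node
    \<open>v\<close>.\<close>
  have "v \<in> \<tau> \<Longrightarrow> length v + j = h \<Longrightarrow> deriv j (lab v)" for v j
  proof (induction j arbitrary: v)
    case 0
    obtain ks where ks: "set ks = {k. v @ [k] \<in> \<tau>}"
      "rule_inst 1 (map (\<lambda>k. lab (v @ [k])) ks) (lab v)"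
      using step[OF 0(1)] by blast
    have "v @ [k] \<notin> \<tau>" for k using len[of "v @ [k]"] 0(2) by auto
    then have "ks = []" using ks(1) by simp
    then show ?case using ks(2) by simp
  next
    case (Suc j)
    obtain ks where ks: "set ks = {k. v @ [k] \<in> \<tau>}"
      "rule_inst 1 (map (\<lambda>k. lab (v @ [k])) ks) (lab v)"
      using step[OF Suc.prems(1)] by blast
    have "deriv j (lab (v @ [k]))" if "k \<in> set ks" for k
      using Suc.IH[of "v @ [k]"] Suc.prems(2) that ks(1) by simp
    then show ?case
      using ks(2) unfolding deriv.simps
      by (intro exI[of _ "map (\<lambda>k. lab (v @ [k])) ks"]) auto
  qed
  moreover have "[] \<in> \<tau>" using tree unfolding rooted_tree_def by (metis append_Nil ex_in_conv)
  ultimately have "deriv h (lab [])" by simp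
  then show ?thesis by (simp add: root)
qed

section \<open>Refuting derivations along a branch\<close>

context omega_embedding
begin

text \<open>\<open>TI_concl prec\<close> holds in some sets of a cone, for instance in finite
  nonempty ones, so it is carried along unconditionally. Only its instances are made false, as they
  come up.\<close>

definition refuted :: "(nat \<Rightarrow> nat) \<Rightarrow> nat set set \<Rightarrow> fm \<Rightarrow> bool" where
  "refuted e C \<phi> \<longleftrightarrow> \<phi> = TI_concl prec \<or> tame \<phi> \<and> (\<forall>S\<in>C. \<not> sat S e \<phi>)"

lemma refuted_mono: "refuted e C \<phi> \<Longrightarrow> C' \<subseteq> C \<Longrightarrow> refuted e C' \<phi>"
  by (auto simp: refuted_def)

lemma refutedI: "tame \<phi> \<Longrightarrow> (\<And>S. S \<in> C \<Longrightarrow> \<not> sat S e \<phi>) \<Longrightarrow> refuted e C \<phi>"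
  by (simp add: refuted_def)

lemma refuted_fresh:
  assumes "a \<notin> FV \<Gamma>" "\<phi> \<in> \<Gamma>" "refuted e C \<phi>"
  shows "refuted (e(a := m)) C \<phi>"
  using assms(3) sat_fresh[OF assms(1,2)] by (simp add: refuted_def)

text \<open>Induction on the height: every rule with premises has one whose new formulas can be made
  false on a smaller cone, with the exponent of the room lowered by one. An initial sequent cannot
  be false in a member of a nonempty cone.\<close>

lemma deriv_not_refuted:
  assumes "deriv j \<Gamma>" "good j C" "\<And>\<phi>. \<phi> \<in> \<Gamma> \<Longrightarrow> refuted e C \<phi>"
  shows False
  using assms
proof (induction j arbitrary: \<Gamma> C e)
  have init: False if "good j C" "Pos a \<in> \<Gamma>" "Neg a \<in> \<Gamma>" "\<And>\<phi>. \<phi> \<in> \<Gamma> \<Longrightarrow> refuted e C \<phi>"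
    for j a C \<Gamma> e
    using good_nonempty[OF that(1)] that(4)[OF that(2)] that(4)[OF that(3)]
    by (auto simp: refuted_def TI_concl_def)
  {
    case 0
    then have "rule_inst 1 [] \<Gamma>" by simp
    then show ?case by cases (use init[OF 0(2) _ _ 0(3)] in auto)
  next
    case (Suc j)
    obtain Ps where Ps: "rule_inst 1 Ps \<Gamma>" "\<And>\<Delta>. \<Delta> \<in> set Ps \<Longrightarrow> deriv j \<Delta>"
      using Suc.prems(1) by auto
    note C = Suc.prems(2) and \<Gamma> = Suc.prems(3)
    \<comment> \<open>\<open>\<Gamma>\<close> stays refuted on smaller cones, so only the formulas
      \<open>A\<close> added by the rule have to be treated.\<close>
    have refutes: False
      if "\<Delta> \<in> set Ps" "\<Delta> \<subseteq> \<Gamma> \<union> A" "good j C'" "C' \<subseteq> C"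
        "\<And>\<phi>. \<phi> \<in> A \<Longrightarrow> refuted e C' \<phi>" for \<Delta> A C'
      by (rule Suc.IH[OF Ps(2)[OF that(1)] that(3), of e])
        (use that(2,5) refuted_mono[OF \<Gamma> that(4)] in blast)
    \<comment> \<open>An eigenvariable may moreover be given any value, as \<open>\<Gamma>\<close>
      does not contain it.\<close>
    have refutes_fresh: False
      if "\<Delta> \<in> set Ps" "\<Delta> \<subseteq> \<Gamma> \<union> A" "good j C'" "C' \<subseteq> C" "a \<notin> FV \<Gamma>"
        "\<And>\<phi>. \<phi> \<in> A \<Longrightarrow> refuted (e(a := m)) C' \<phi>" for \<Delta> A C' a m
      by (rule Suc.IH[OF Ps(2)[OF that(1)] that(3), of "e(a := m)"])
        (use that(2,6) refuted_fresh[OF that(5) _ refuted_mono[OF \<Gamma> that(4)]] in blast)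
    have Cj: "good j C" using good_pred[OF C] .
    from Ps(1) show ?case
    proof cases
      case (initial a)
      then show ?thesis using init[OF C _ _ \<Gamma>] by blast
    next
      case (disj \<phi>\<^sub>1 \<phi>\<^sub>2 \<phi>)
      show ?thesis
      proof (rule refutes[OF _ _ Cj subset_refl, of "insert \<phi> \<Gamma>" "{\<phi>}"])
        show "refuted e C \<psi>" if "\<psi> \<in> {\<phi>}" for \<psi>
          using \<Gamma>[OF disj(2)] disj(3) that by (auto simp: refuted_def TI_concl_def)
      qed (use disj in auto)
    next
      case (conj \<phi>\<^sub>1 \<phi>\<^sub>2)
      have tame: "tame \<phi>\<^sub>1" "tame \<phi>\<^sub>2" "local \<phi>\<^sub>1" and false: "\<And>S. S \<in> C \<Longrightarrow> \<not> sat S e (Conj \<phi>\<^sub>1 \<phi>\<^sub>2)"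
        using \<Gamma>[OF conj(2)] by (auto simp: refuted_def TI_concl_def)
      \<comment> \<open>Deciding the left conjunct suffices: where it is true throughout, the right
        one is false throughout.\<close>
      obtain C' where C': "C' \<subseteq> C" "good j C'"
        "(\<forall>S\<in>C'. sat S e \<phi>\<^sub>1) \<or> (\<forall>S\<in>C'. \<not> sat S e \<phi>\<^sub>1)"
        using good_decide[OF Cj tame(3)] by blast
      from C'(3) show ?thesis
      proof
        assume "\<forall>S\<in>C'. sat S e \<phi>\<^sub>1"
        then have "refuted e C' \<phi>\<^sub>2" using false C'(1) tame by (auto intro!: refutedI)
        then show ?thesis
          by (intro refutes[OF _ _ C'(2,1), of "insert \<phi>\<^sub>2 \<Gamma>" "{\<phi>\<^sub>2}"]) (auto simp: conj(1))
      next
        assume "\<forall>S\<in>C'. \<not> sat S e \<phi>\<^sub>1"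
        then have "refuted e C' \<phi>\<^sub>1" using tame by (auto intro!: refutedI)
        then show ?thesis
          by (intro refutes[OF _ _ C'(2,1), of "insert \<phi>\<^sub>1 \<Gamma>" "{\<phi>\<^sub>1}"]) (auto simp: conj(1))
      qed
    next
      case (ex \<phi> u)
      show ?thesis
      proof (cases "Ex \<phi> = TI_concl prec")
        case True
        then have \<phi>: "\<phi> = All (TI_matrix prec)" by (simp add: TI_concl_eq)
        \<comment> \<open>The term \<open>u\<close> proposes a least element; \<open>m\<close> is
          the counterexample to its minimality.\<close>
        obtain m C' where C': "C' \<subseteq> C" "good j C'"
          "\<forall>S\<in>C'. eval e u \<in> S \<longrightarrow> m \<in> S \<and> prec m (eval e u)"
          using good_descend[OF C] by blast
        have "refuted e C' (inst u \<phi>)"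
        proof (rule refutedI)
          show "tame (inst u \<phi>)"
            by (rule tame_inst) (simp add: \<phi> tame_TI_matrix local_TI_matrix)
          show "\<not> sat S e (inst u \<phi>)" if "S \<in> C'" for S
            using C'(3) that by (auto simp: sat_inst \<phi> sat_TI_matrix)
        qed
        then show ?thesis
          by (intro refutes[OF _ _ C'(2,1), of "insert (inst u \<phi>) \<Gamma>" "{inst u \<phi>}"])
            (auto simp: ex(1))
      next
        case False
        then have "refuted e C (inst u \<phi>)"
          using \<Gamma>[OF ex(2)] by (auto simp: refuted_def sat_inst intro: tame_inst)
        then show ?thesis
          by (intro refutes[OF _ _ Cj subset_refl, of "insert (inst u \<phi>) \<Gamma>" "{inst u \<phi>}"])
            (auto simp: ex(1))
      qed
    next
      case (all \<phi> a)
      have tame: "tame \<phi>" "local \<phi>" and false: "\<And>S. S \<in> C \<Longrightarrow> \<exists>n. sat S (case_nat n e) (neg \<phi>)"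
        using \<Gamma>[OF all(2)] by (auto simp: refuted_def TI_concl_def)
      \<comment> \<open>One counterexample for the whole cone becomes the value of the
        eigenvariable.\<close>
      obtain m C' where C': "C' \<subseteq> C" "good j C'" "\<forall>S\<in>C'. sat S (case_nat m e) (neg \<phi>)"
        using good_witness[OF Cj _ false] tame(2) by auto
      have "Suc a \<notin> fv \<phi>" using all(2,3) by (auto simp: FV_def)
      then have "refuted (e(a := m)) C' (inst (Var a) \<phi>)"
        using C'(3) by (intro refutedI) (auto simp: tame tame_inst sat_inst sat_inst_Var_fresh)
      then show ?thesis
        by (intro refutes_fresh[OF _ _ C'(2,1) all(3),
              of "insert (inst (Var a) \<phi>) \<Gamma>" "{inst (Var a) \<phi>}"])
          (auto simp: all(1))
    next
      case (true_sentence \<phi>)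
      then have "refuted e C (neg \<phi>)"
        by (intro refutedI) (auto simp: ThN_def pSigma_def tame_X_free)
      then show ?thesis
        by (intro refutes[OF _ _ Cj subset_refl, of "insert (neg \<phi>) \<Gamma>" "{neg \<phi>}"])
          (auto simp: true_sentence(1))
    next
      case (induction \<phi> t a)
      obtain \<psi> where \<psi>: "\<phi> = Ex \<psi>" "tame \<psi>" "local \<psi>"
        using pSigmaX_1_cases[OF induction(2)] .
      have tame: "tame \<phi>" using \<psi> by simp
      have a: "a \<notin> FV \<Gamma>" "Suc a \<notin> fv \<phi>"
        using induction(7) fv_inst_superset[of \<phi> zero_tm] by (auto simp: FV_def)
      have "\<exists>M. \<forall>S'. S' \<inter> {..<M} = S \<inter> {..<M} \<longrightarrow> sat S' (case_nat i e) \<phi>"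
        if "sat S (case_nat i e) \<phi>" for i S
        using Ex_local_open[OF \<psi>(3) that[unfolded \<psi>(1)]] unfolding \<psi>(1) by blast
      \<comment> \<open>The induction runs up to the value of \<open>t\<close>; the three
        alternatives refute the three premises, with \<open>m\<close> as the value of the
        eigenvariable.\<close>
      from good_induction[where \<Phi> = "\<lambda>i S. sat S (case_nat i e) \<phi>" and n = "eval e t", OF C this]
      obtain m C' where C': "C' \<subseteq> C" "good j C'"
        and "(\<forall>S\<in>C'. \<not> sat S (case_nat 0 e) \<phi>) \<or>
          (\<forall>S\<in>C'. sat S (case_nat m e) \<phi> \<and> \<not> sat S (case_nat (Suc m) e) \<phi>) \<or>
          (\<forall>S\<in>C'. sat S (case_nat (eval e t) e) \<phi>)"
        by blast
      then consider "\<forall>S\<in>C'. \<not> sat S (case_nat 0 e) \<phi>"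
        | "\<forall>S\<in>C'. sat S (case_nat m e) \<phi> \<and> \<not> sat S (case_nat (Suc m) e) \<phi>"
        | "\<forall>S\<in>C'. sat S (case_nat (eval e t) e) \<phi>"
        by blast
      then show ?thesis
      proof cases
        case 1
        then have "refuted e C' (inst zero_tm \<phi>)"
          by (intro refutedI) (auto simp: tame tame_inst sat_inst)
        then show ?thesis
          by (intro refutes[OF _ _ C'(2,1), of "insert (inst zero_tm \<phi>) \<Gamma>" "{inst zero_tm \<phi>}"])
            (auto simp: induction(1))
      next
        case 2
        then have "refuted (e(a := m)) C' (neg (inst (Var a) \<phi>))"
          "refuted (e(a := m)) C' (inst (plus_tm (Var a) one_tm) \<phi>)"
          by (auto simp: tame tame_inst sat_inst sat_inst_Var_fresh[OF a(2)] intro!: refutedI)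
        then show ?thesis
          by (intro refutes_fresh[OF _ _ C'(2,1) a(1),
                of "\<Gamma> \<union> {neg (inst (Var a) \<phi>), inst (plus_tm (Var a) one_tm) \<phi>}"
                  "{neg (inst (Var a) \<phi>), inst (plus_tm (Var a) one_tm) \<phi>}"])
            (auto simp: induction(1))
      next
        case 3
        then have "refuted e C' (neg (inst t \<phi>))"
          by (intro refutedI) (auto simp: tame tame_inst sat_inst)
        then show ?thesis
          by (intro refutes[OF _ _ C'(2,1), of "insert (neg (inst t \<phi>)) \<Gamma>" "{neg (inst t \<phi>)}"])
            (auto simp: induction(1))
      qed
    next
      case (cut \<phi>)
      obtain \<psi> where \<psi>: "\<phi> = Ex \<psi>" "tame \<psi>" "local \<psi>"
        using pSigmaX_1_cases[OF cut(2)] .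
      have tame: "tame \<phi>" using \<psi> by simp
      have "\<exists>M. \<forall>S'. S' \<inter> {..<M} = S \<inter> {..<M} \<longrightarrow> sat S' e \<phi>" if "sat S e \<phi>" for S
        using Ex_local_open[OF \<psi>(3) that[unfolded \<psi>(1)]] unfolding \<psi>(1) by blast
      \<comment> \<open>A cut is treated as a degenerate induction: with \<Phi> independent of i,
        the middle alternative contradicts itself on every set, so \<phi> gets decided.\<close>
      from good_induction[where \<Phi> = "\<lambda>i S. sat S e \<phi>" and n = 0, OF C this]
      obtain C' where C': "C' \<subseteq> C" "good j C'" "(\<forall>S\<in>C'. \<not> sat S e \<phi>) \<or> (\<forall>S\<in>C'. sat S e \<phi>)"
        by blast
      from C'(3) show ?thesis
      proof
        assume "\<forall>S\<in>C'. \<not> sat S e \<phi>"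
        then have "refuted e C' \<phi>" using tame by (intro refutedI) auto
        then show ?thesis
          by (intro refutes[OF _ _ C'(2,1), of "insert \<phi> \<Gamma>" "{\<phi>}"]) (auto simp: cut(1))
      next
        assume "\<forall>S\<in>C'. sat S e \<phi>"
        then have "refuted e C' (neg \<phi>)" using tame by (intro refutedI) auto
        then show ?thesis
          by (intro refutes[OF _ _ C'(2,1), of "insert (neg \<phi>) \<Gamma>" "{neg \<phi>}"])
            (auto simp: cut(1))
      qed
    qed
  }
qed

lemma not_deriv_TI:
  assumes "h \<in> H"
  shows "\<not> deriv h (TI prec)"
proof
  assume *: "deriv h (TI prec)"
  obtain m C where C: "good h C" "\<forall>S\<in>C. m \<in> S" using good_start[OF assms] by blast
  have "refuted e C \<phi>" if "\<phi> \<in> TI prec" for \<phi> e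
    using that C(2) by (auto simp: TI_def TI_hyp_def refuted_def)
  with * C(1) show False by (rule deriv_not_refuted)
qed

end

section \<open>Forcing with sequences of approximations\<close>

text \<open>
  Names are sequences of natural numbers, and a condition is a sequence of states whose room
  $\omega^j$ is unbounded, so that finitely many steps never exhaust it.  A coordinate can be
  dropped from a condition by making it empty.
\<close>

type_synonym condition = "nat \<Rightarrow> nat set set"
type_synonym names = "nat \<Rightarrow> nat \<Rightarrow> nat"

definition holds :: "condition \<Rightarrow> names \<Rightarrow> fm \<Rightarrow> bool" where
  "holds c e \<phi> \<longleftrightarrow> (\<forall>i. \<forall>S\<in>c i. sat S (\<lambda>n. e n i) \<phi>)"

lemma holds_mono: "holds c e \<phi> \<Longrightarrow> d \<le> c \<Longrightarrow> holds d e \<phi>"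
  unfolding holds_def le_fun_def by blast

lemma case_nat_names: "(\<lambda>n. case_nat x e n i) = case_nat (x i) (\<lambda>n. e n i)"
  by (auto simp: fun_eq_iff split: nat.split)

section \<open>Conditions and their refinement\<close>

locale omega_embeddings = omega_embedding prec UNIV emb for prec emb
begin

definition cond :: "condition \<Rightarrow> bool" where
  "cond c \<longleftrightarrow> (\<forall>k. \<exists>i\<ge>k. good k (c i))"

text \<open>Lowering the level by one at each coordinate keeps the levels unbounded. A step costing
  one level can thus be made everywhere at once, its witnesses forming the name
  \<open>x\<close>.\<close>

lemma cond_select:
  assumes "cond c"
    and step: "\<forall>i k. good (Suc k) (c i) \<longrightarrow> (\<exists>n. \<exists>C\<subseteq>c i. good k C \<and> Q i n C)"
  shows "\<exists>x d. cond d \<and> d \<le> c \<and> (\<forall>i. d i \<noteq> {} \<longrightarrow> Q i (x i) (d i))"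
proof -
  \<comment> \<open>The cap \<open>k \<le> i\<close> makes a greatest level exist. As
    \<open>cond\<close> provides high levels at large indices, the capped levels are still
    unbounded.\<close>
  define g where "g i = (GREATEST k. k \<le> i \<and> good (Suc k) (c i))" for i
  have g: "k \<le> g i" "good (Suc (g i)) (c i)" if "k \<le> i" "good (Suc k) (c i)" for i k
  proof -
    let ?P = "\<lambda>k. k \<le> i \<and> good (Suc k) (c i)"
    have "?P k" "\<And>y. ?P y \<Longrightarrow> y \<le> i" using that by simp_all
    from GreatestI_nat[of ?P, OF this] Greatest_le_nat[of ?P, OF this]
    show "k \<le> g i" "good (Suc (g i)) (c i)" unfolding g_def by simp_all
  qed
  let ?R = "\<lambda>i n C. C \<subseteq> c i \<and> (good (Suc (g i)) (c i) \<longrightarrow> good (g i) C) \<and> (C \<noteq> {} \<longrightarrow> Q i n C)"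
  have "\<forall>i. \<exists>n C. ?R i n C"
  proof
    fix i
    show "\<exists>n C. ?R i n C"
    proof (cases "good (Suc (g i)) (c i)")
      case True
      then obtain n C where "C \<subseteq> c i" "good (g i) C" "Q i n C" using step[rule_format, OF True] by (elim exE conjE)
      then show ?thesis by (intro exI[of _ n] exI[of _ C]) simp
    \<comment> \<open>A coordinate with no level to spare is dropped.\<close>
    qed (auto intro: exI[of _ "{}"])
  qed
  from choice[OF this] obtain x where "\<forall>i. \<exists>C. ?R i (x i) C" by (elim exE)
  from choice[OF this] obtain d where "\<forall>i. ?R i (x i) (d i)" by (elim exE)
  then have d: "\<And>i. d i \<subseteq> c i" "\<And>i. good (Suc (g i)) (c i) \<Longrightarrow> good (g i) (d i)"
    "\<And>i. d i \<noteq> {} \<Longrightarrow> Q i (x i) (d i)"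
    by simp_all
  have "\<exists>i\<ge>k. good k (d i)" for k
  proof -
    obtain i where i: "Suc k \<le> i" "good (Suc k) (c i)" using assms(1) unfolding cond_def by blast
    then have "k \<le> g i" "good (Suc (g i)) (c i)" using g[of k i] by auto
    then have "good k (d i)" using d(2) good_antimono by blast
    with i(1) show ?thesis by (auto intro: Suc_leD)
  qed
  with d(1,3) show ?thesis
    by (intro exI[of _ x] exI[of _ d]) (simp add: cond_def le_fun_def)
qed

text \<open>If both parts had bounded levels, a coordinate with index and level beyond both bounds
  would lie in neither.\<close>

lemma cond_split:
  assumes "cond c" "\<forall>i. c i \<noteq> {} \<longrightarrow> P i \<or> Q i"
  shows "\<exists>d\<le>c. cond d \<and> ((\<forall>i. d i \<noteq> {} \<longrightarrow> P i) \<or> (\<forall>i. d i \<noteq> {} \<longrightarrow> Q i))"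
proof (rule ccontr)
  assume neg: "\<not> ?thesis"
  let ?d = "\<lambda>R i. if R i then c i else {}"
  have le: "?d R \<le> c" for R by (simp add: le_fun_def)
  have "\<not> cond (?d P)" "\<not> cond (?d Q)"
    by (rule notI, rule notE[OF neg], intro exI[of _ "?d _"] conjI le, assumption, simp)+
  then obtain k l where kl: "\<And>i. i \<ge> k \<Longrightarrow> \<not> good k (?d P i)" "\<And>i. i \<ge> l \<Longrightarrow> \<not> good l (?d Q i)"
    unfolding cond_def by blast
  obtain i where i: "max k l \<le> i" "good (max k l) (c i)" using assms(1) unfolding cond_def by blast
  then have "good k (c i)" "good l (c i)" by (auto intro: good_antimono[rotated])
  moreover have "P i \<or> Q i" using assms(2)[rule_format, OF good_nonempty[OF i(2)]] .
  ultimately show False using kl(1)[of i] kl(2)[of i] i(1) by auto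
qed

lemma cond_nonempty: "cond c \<Longrightarrow> \<exists>i S. S \<in> c i"
  unfolding cond_def using good_nonempty by blast

text \<open>Each coordinate can be decided by itself, but with its own verdict; splitting the
  coordinates by verdict makes the remaining ones agree.\<close>

lemma cond_decide:
  assumes "cond c" "local \<phi>"
  shows "\<exists>d\<le>c. cond d \<and> (holds d e \<phi> \<or> holds d e (neg \<phi>))"
proof -
  let ?Q = "\<lambda>i (b :: nat) C. (\<forall>S\<in>C. sat S (\<lambda>n. e n i) \<phi>) \<or> (\<forall>S\<in>C. \<not> sat S (\<lambda>n. e n i) \<phi>)"
  have "\<forall>i k. good (Suc k) (c i) \<longrightarrow> (\<exists>n. \<exists>C\<subseteq>c i. good k C \<and> ?Q i n C)"
  proof (intro allI impI)
    fix i k assume "good (Suc k) (c i)"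
    then have "good k (c i)" by (rule good_pred)
    then obtain C where "C \<subseteq> c i" "good k C" "?Q i 0 C"
      using assms(2) by (rule good_decide[of k "c i" \<phi> "\<lambda>n. e n i"])
    then show "\<exists>n. \<exists>C\<subseteq>c i. good k C \<and> ?Q i n C" by (intro exI conjI)
  qed
  from cond_select[OF assms(1), of ?Q, OF this]
  obtain d where d: "cond d" "d \<le> c" "\<forall>i. d i \<noteq> {} \<longrightarrow> ?Q i 0 (d i)"
    by (elim exE conjE)
  from cond_split[OF d(1), of "\<lambda>i. \<forall>S\<in>d i. sat S (\<lambda>n. e n i) \<phi>"
      "\<lambda>i. \<forall>S\<in>d i. \<not> sat S (\<lambda>n. e n i) \<phi>", OF d(3)]
  obtain d' where d': "d' \<le> d" "cond d'"
    "(\<forall>i. d' i \<noteq> {} \<longrightarrow> (\<forall>S\<in>d i. sat S (\<lambda>n. e n i) \<phi>)) \<or>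
     (\<forall>i. d' i \<noteq> {} \<longrightarrow> (\<forall>S\<in>d i. \<not> sat S (\<lambda>n. e n i) \<phi>))"
    by (elim exE conjE)
  have sub: "d' i \<subseteq> d i" for i using d'(1) by (simp add: le_fun_def)
  have "holds d' e \<phi> \<or> holds d' e (neg \<phi>)"
    using d'(3) sub unfolding holds_def sat_neg by blast
  with d'(1,2) d(2) show ?thesis using order_trans by blast
qed

section \<open>Weak forcing\<close>

definition densely :: "(condition \<Rightarrow> bool) \<Rightarrow> condition \<Rightarrow> bool" where
  "densely P c \<longleftrightarrow> (\<forall>d\<le>c. cond d \<longrightarrow> (\<exists>d'\<le>d. cond d' \<and> P d'))"

lemma densely_mono: "densely P c \<Longrightarrow> d \<le> c \<Longrightarrow> densely P d"
  unfolding densely_def by (meson order_trans)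

lemma densely_densely: "densely (densely P) c \<Longrightarrow> densely P c"
  unfolding densely_def by (meson order_refl order_trans)

lemma densely_weaken: "densely P c \<Longrightarrow> (\<And>d. P d \<Longrightarrow> Q d) \<Longrightarrow> densely Q c"
  unfolding densely_def by blast

lemma denselyE:
  assumes "densely P c" "cond c"
  obtains d where "d \<le> c" "cond d" "P d"
  using assms unfolding densely_def by blast

text \<open>In negation normal form, weak forcing asks for the choices of disjunctions and
  existential quantifiers only densely, which yields classical logic. Quantifiers range over
  names.\<close>

primrec forces :: "fm \<Rightarrow> names \<Rightarrow> condition \<Rightarrow> bool" where
  "forces (Pos a) e c \<longleftrightarrow> densely (\<lambda>d. holds d e (Pos a)) c"
| "forces (Neg a) e c \<longleftrightarrow> densely (\<lambda>d. holds d e (Neg a)) c"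
| "forces (Conj \<phi> \<psi>) e c \<longleftrightarrow> forces \<phi> e c \<and> forces \<psi> e c"
| "forces (Disj \<phi> \<psi>) e c \<longleftrightarrow> densely (\<lambda>d. forces \<phi> e d \<or> forces \<psi> e d) c"
| "forces (All \<phi>) e c \<longleftrightarrow> (\<forall>x. forces \<phi> (case_nat x e) c)"
| "forces (Ex \<phi>) e c \<longleftrightarrow> densely (\<lambda>d. \<exists>x. forces \<phi> (case_nat x e) d) c"

lemma forces_mono: "forces \<phi> e c \<Longrightarrow> d \<le> c \<Longrightarrow> forces \<phi> e d"
  by (induction \<phi> arbitrary: e) (auto elim: densely_mono)

text \<open>Only conjunction and universal quantification use the induction hypothesis; every other
  clause has the form \<open>densely\<close>, and density is idempotent.\<close>

lemma densely_forces: "densely (forces \<phi> e) c \<Longrightarrow> forces \<phi> e c"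
proof (induction \<phi> arbitrary: e)
  case (Conj \<phi> \<psi>)
  have "densely (forces \<phi> e) c" "densely (forces \<psi> e) c"
    using Conj.prems by (rule densely_weaken, simp)+
  with Conj.IH show ?case by simp
next
  case (All \<phi>)
  have "densely (forces \<phi> (case_nat x e)) c" for x
    using All.prems by (rule densely_weaken) simp
  with All.IH show ?case by simp
qed (simp_all, (rule densely_densely, erule densely_weaken, simp)+)

lemma densely_holds: "holds c e \<phi> \<Longrightarrow> densely (\<lambda>d. holds d e \<phi>) c"
  unfolding densely_def using holds_mono[of c e \<phi>] by blast

lemma forces_DisjI1: "forces \<phi> e c \<Longrightarrow> forces (Disj \<phi> \<psi>) e c"
  unfolding forces.simps densely_def using forces_mono[of \<phi> e c] by blast

lemma forces_DisjI2: "forces \<psi> e c \<Longrightarrow> forces (Disj \<phi> \<psi>) e c"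
  unfolding forces.simps densely_def using forces_mono[of \<psi> e c] by blast

lemma forces_ExI: "forces \<phi> (case_nat x e) c \<Longrightarrow> forces (Ex \<phi>) e c"
  unfolding forces.simps densely_def using forces_mono[of \<phi> "case_nat x e" c] by blast

text \<open>Since \<open>neg\<close> is a syntactic operation, consistency is not built into
  \<open>forces\<close> and is proved by induction. Opposite atoms would have to be true together in
  a set at a nonempty coordinate.\<close>

lemma forces_neg_consistent: "cond c \<Longrightarrow> forces \<phi> e c \<Longrightarrow> forces (neg \<phi>) e c \<Longrightarrow> False"
proof (induction \<phi> arbitrary: e c)
  case (Pos a)
  then obtain d where d: "d \<le> c" "cond d" "holds d e (Pos a)" by (auto elim: denselyE)
  then have "densely (\<lambda>d. holds d e (Neg a)) d" using Pos.prems(3) densely_mono by auto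
  then obtain d' where d': "d' \<le> d" "cond d'" "holds d' e (Neg a)" using d(2) by (rule denselyE)
  with holds_mono[OF d(3)] cond_nonempty[OF d'(2)] show ?case by (force simp: holds_def)
next
  case (Neg a)
  then obtain d where d: "d \<le> c" "cond d" "holds d e (Neg a)" by (auto elim: denselyE)
  then have "densely (\<lambda>d. holds d e (Pos a)) d" using Neg.prems(3) densely_mono by auto
  then obtain d' where d': "d' \<le> d" "cond d'" "holds d' e (Pos a)" using d(2) by (rule denselyE)
  with holds_mono[OF d(3)] cond_nonempty[OF d'(2)] show ?case by (force simp: holds_def)
next
  case (Conj \<phi> \<psi>)
  then obtain d where d: "d \<le> c" "cond d" "forces (neg \<phi>) e d \<or> forces (neg \<psi>) e d"
    by (auto elim: denselyE)
  have "forces \<phi> e d" "forces \<psi> e d" using Conj.prems(2) forces_mono[OF _ d(1)] by auto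
  with Conj.IH d(2,3) show ?case by blast
next
  case (Disj \<phi> \<psi>)
  then obtain d where d: "d \<le> c" "cond d" "forces \<phi> e d \<or> forces \<psi> e d"
    by (auto elim: denselyE)
  have "forces (neg \<phi>) e d" "forces (neg \<psi>) e d"
    using Disj.prems(3) forces_mono[OF _ d(1)] by auto
  with Disj.IH d(2,3) show ?case by blast
next
  case (All \<phi>)
  have "densely (\<lambda>d. \<exists>x. forces (neg \<phi>) (case_nat x e) d) c" using All.prems(3) by simp
  then obtain d x where d: "d \<le> c" "cond d" "forces (neg \<phi>) (case_nat x e) d"
    using All.prems(1) denselyE by blast
  have "forces \<phi> (case_nat x e) d" using All.prems(2) forces_mono[OF _ d(1)] by simp
  with All.IH d(2,3) show ?case by blast
next
  case (Ex \<phi>)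
  have "densely (\<lambda>d. \<exists>x. forces \<phi> (case_nat x e) d) c" using Ex.prems(2) by simp
  then obtain d x where d: "d \<le> c" "cond d" "forces \<phi> (case_nat x e) d"
    using Ex.prems(1) denselyE by blast
  have "forces (neg \<phi>) (case_nat x e) d" using Ex.prems(3) forces_mono[OF _ d(1)] by simp
  with Ex.IH d(2,3) show ?case by blast
qed

text \<open>Atoms are local and decided by \<open>cond_decide\<close>. For \<open>All\<close>,
  either some condition below forces a counterexample, or every instance is forced densely and hence
  outright; \<open>Ex\<close> is dual.\<close>

lemma forces_decide: "cond c \<Longrightarrow> \<exists>d\<le>c. cond d \<and> (forces \<phi> e d \<or> forces (neg \<phi>) e d)"
proof (induction \<phi> arbitrary: e c)
  case (Pos a)
  from cond_decide[OF Pos, of "Pos a" e] show ?case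
    by (auto intro: densely_holds)
next
  case (Neg a)
  from cond_decide[OF Neg, of "Neg a" e] show ?case
    by (auto intro: densely_holds)
next
  case (Conj \<phi> \<psi>)
  obtain d where d: "d \<le> c" "cond d" "forces \<phi> e d \<or> forces (neg \<phi>) e d"
    using Conj.IH(1)[OF Conj.prems] by blast
  obtain d' where d': "d' \<le> d" "cond d'" "forces \<psi> e d' \<or> forces (neg \<psi>) e d'"
    using Conj.IH(2)[OF d(2)] by blast
  have "forces (Conj \<phi> \<psi>) e d' \<or> forces (neg (Conj \<phi> \<psi>)) e d'"
    using d(3) d'(3) forces_mono[OF _ d'(1)] unfolding neg.simps
    by (metis forces.simps(3) forces_DisjI1 forces_DisjI2)
  then show ?case using d d' order_trans by blast
next
  case (Disj \<phi> \<psi>)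
  obtain d where d: "d \<le> c" "cond d" "forces \<phi> e d \<or> forces (neg \<phi>) e d"
    using Disj.IH(1)[OF Disj.prems] by blast
  obtain d' where d': "d' \<le> d" "cond d'" "forces \<psi> e d' \<or> forces (neg \<psi>) e d'"
    using Disj.IH(2)[OF d(2)] by blast
  have "forces (Disj \<phi> \<psi>) e d' \<or> forces (neg (Disj \<phi> \<psi>)) e d'"
    using d(3) d'(3) forces_mono[OF _ d'(1)] unfolding neg.simps
    by (metis forces.simps(3) forces_DisjI1 forces_DisjI2)
  then show ?case using d d' order_trans by blast
next
  case (All \<phi>)
  show ?case
  proof (cases "\<exists>x. \<exists>d\<le>c. cond d \<and> forces (neg \<phi>) (case_nat x e) d")
    case True
    then obtain x d where d: "d \<le> c" "cond d" "forces (neg \<phi>) (case_nat x e) d" by blast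
    have "forces (neg (All \<phi>)) e d"
      unfolding neg.simps using d(3) by (rule forces_ExI)
    with d show ?thesis by blast
  next
    case False
    have "densely (forces \<phi> (case_nat x e)) c" for x
      unfolding densely_def using All.IH False order_trans by meson
    then have "forces (All \<phi>) e c" using densely_forces by simp
    with All.prems show ?thesis by blast
  qed
next
  case (Ex \<phi>)
  show ?case
  proof (cases "\<exists>x. \<exists>d\<le>c. cond d \<and> forces \<phi> (case_nat x e) d")
    case True
    then obtain x d where d: "d \<le> c" "cond d" "forces \<phi> (case_nat x e) d" by blast
    have "forces (Ex \<phi>) e d"
      using d(3) by (rule forces_ExI)
    with d show ?thesis by blast
  next
    case False
    have "densely (forces (neg \<phi>) (case_nat x e)) c" for x
      unfolding densely_def using Ex.IH False order_trans by meson
    then have "forces (neg (Ex \<phi>)) e c" using densely_forces by simp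
    with Ex.prems show ?thesis by blast
  qed
qed

lemma forcesI:
  assumes "\<And>d. d \<le> c \<Longrightarrow> cond d \<Longrightarrow> \<not> forces (neg \<phi>) e d"
  shows "forces \<phi> e c"
proof (rule densely_forces, unfold densely_def, intro allI impI)
  fix d assume d: "d \<le> c" "cond d"
  obtain d' where d': "d' \<le> d" "cond d'" "forces \<phi> e d' \<or> forces (neg \<phi>) e d'"
    using forces_decide[OF d(2)] by blast
  with assms[OF order_trans[OF d'(1) d(1)]] show "\<exists>d'\<le>d. cond d' \<and> forces \<phi> e d'" by blast
qed

text \<open>Truth may depend on a different disjunct or witness in each set. Locality allows the
  left disjunct to be decided and one witness per coordinate to be fixed; these witnesses form a
  name.\<close>

lemma holds_imp_forces: "tame \<phi> \<Longrightarrow> holds c e \<phi> \<Longrightarrow> forces \<phi> e c"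
proof (induction \<phi> arbitrary: e c)
  case (Disj \<phi> \<psi>)
  show ?case
    unfolding forces.simps densely_def
  proof (intro allI impI)
    fix d assume d: "d \<le> c" "cond d"
    obtain d' where d': "d' \<le> d" "cond d'" "holds d' e \<phi> \<or> holds d' e (neg \<phi>)"
      using cond_decide[OF d(2), of \<phi> e] Disj.prems(1) by auto
    have "holds d' e (Disj \<phi> \<psi>)" using holds_mono[OF Disj.prems(2) order_trans[OF d'(1) d(1)]] .
    then have "holds d' e \<phi> \<or> holds d' e \<psi>"
      using d'(3) unfolding holds_def sat.simps sat_neg by blast
    then show "\<exists>d'\<le>d. cond d' \<and> (forces \<phi> e d' \<or> forces \<psi> e d')"
      using d' Disj.IH Disj.prems(1) by auto
  qed
next
  case (Ex \<phi>)
  show ?case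
    unfolding forces.simps densely_def
  proof (intro allI impI)
    fix d assume d: "d \<le> c" "cond d"
    have h: "holds d e (Ex \<phi>)" using holds_mono[OF Ex.prems(2) d(1)] .
    let ?Q = "\<lambda>i n C. \<forall>S\<in>C. sat S (case_nat n (\<lambda>n. e n i)) \<phi>"
    have "\<forall>i k. good (Suc k) (d i) \<longrightarrow> (\<exists>n. \<exists>C\<subseteq>d i. good k C \<and> ?Q i n C)"
    proof (intro allI impI)
      fix i k assume "good (Suc k) (d i)"
      then show "\<exists>n. \<exists>C\<subseteq>d i. good k C \<and> ?Q i n C"
        by (rule good_witness[OF good_pred]) (use h Ex.prems(1) in \<open>auto simp: holds_def\<close>)
    qed
    from cond_select[OF d(2), of ?Q, OF this]
    obtain x d' where d': "cond d'" "d' \<le> d" "\<forall>i. d' i \<noteq> {} \<longrightarrow> ?Q i (x i) (d' i)"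
      by (elim exE conjE)
    have "holds d' (case_nat x e) \<phi>"
      using d'(3) unfolding holds_def case_nat_names by blast
    then have "forces \<phi> (case_nat x e) d'" using Ex.IH Ex.prems(1) by simp
    with d'(1,2) show "\<exists>d'\<le>d. cond d' \<and> (\<exists>x. forces \<phi> (case_nat x e) d')" by blast
  qed
next
  case (All \<phi>)
  have "holds c (case_nat x e) \<phi>" for x
    using All.prems(2) by (simp add: holds_def case_nat_names)
  with All show ?case by simp
next
  case (Conj \<phi> \<psi>)
  then show ?case by (simp add: holds_def)
qed (simp_all add: densely_holds)

section \<open>Forcing under change of assignment and substitution\<close>

lemma holds_cong: "(\<And>n. n \<in> fv \<phi> \<Longrightarrow> e n = e' n) \<Longrightarrow> holds c e \<phi> = holds c e' \<phi>"
  unfolding holds_def by (intro all_cong1 ball_cong refl sat_cong) simp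

lemma forces_cong: "(\<And>n. n \<in> fv \<phi> \<Longrightarrow> e n = e' n) \<Longrightarrow> forces \<phi> e c = forces \<phi> e' c"
proof (induction \<phi> arbitrary: e e' c)
  case (Pos a)
  then have "holds d e (Pos a) = holds d e' (Pos a)" for d by (intro holds_cong) auto
  then show ?case by simp
next
  case (Neg a)
  then have "holds d e (Neg a) = holds d e' (Neg a)" for d by (intro holds_cong) auto
  then show ?case by simp
next
  case (Conj \<phi> \<psi>)
  have "forces \<phi> e c = forces \<phi> e' c" "forces \<psi> e c = forces \<psi> e' c" for c
    using Conj.prems by (auto intro!: Conj.IH)
  then show ?case by simp
next
  case (Disj \<phi> \<psi>)
  have "forces \<phi> e c = forces \<phi> e' c" "forces \<psi> e c = forces \<psi> e' c" for c
    using Disj.prems by (auto intro!: Disj.IH)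
  then show ?case by simp
next
  case (All \<phi>)
  have "forces \<phi> (case_nat x e) c = forces \<phi> (case_nat x e') c" for x c
    by (rule All.IH) (use All.prems in \<open>auto split: nat.split\<close>)
  then show ?case by simp
next
  case (Ex \<phi>)
  have "forces \<phi> (case_nat x e) c = forces \<phi> (case_nat x e') c" for x c
    by (rule Ex.IH) (use Ex.prems in \<open>auto split: nat.split\<close>)
  then show ?case by simp
qed

definition name_eval :: "names \<Rightarrow> tm \<Rightarrow> nat \<Rightarrow> nat" where
  "name_eval e t = (\<lambda>i. eval (\<lambda>n. e n i) t)"

lemma name_eval_lift_sub:
  "(\<lambda>n. name_eval (case_nat x e) (lift_sub \<sigma> n)) = case_nat x (\<lambda>n. name_eval e (\<sigma> n))"
  by (auto simp: fun_eq_iff name_eval_def case_nat_names lift_sub_def split: nat.split)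

lemma holds_subst: "holds c e (subst_fm \<sigma> \<phi>) = holds c (\<lambda>n. name_eval e (\<sigma> n)) \<phi>"
  by (simp add: holds_def sat_subst name_eval_def)

lemma forces_subst: "forces (subst_fm \<sigma> \<phi>) e c = forces \<phi> (\<lambda>n. name_eval e (\<sigma> n)) c"
proof (induction \<phi> arbitrary: e \<sigma> c)
  case (Pos a)
  show ?case using holds_subst[of _ e \<sigma> "Pos a"] by simp
next
  case (Neg a)
  show ?case using holds_subst[of _ e \<sigma> "Neg a"] by simp
qed (simp_all add: name_eval_lift_sub)

lemma name_eval_case_nat:
  "(\<lambda>n. name_eval e (case_nat u Var n)) = case_nat (name_eval e u) e"
  by (auto simp: fun_eq_iff name_eval_def split: nat.split)

lemma forces_inst: "forces (inst u \<phi>) e c = forces \<phi> (case_nat (name_eval e u) e) c"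
  by (simp add: inst_def forces_subst name_eval_case_nat)

section \<open>Soundness of the sequent calculus for weak forcing\<close>

definition valid :: "fm set \<Rightarrow> bool" where
  "valid \<Gamma> \<longleftrightarrow> (\<forall>e c. cond c \<longrightarrow> (\<exists>\<phi>\<in>\<Gamma>. \<exists>d\<le>c. cond d \<and> forces \<phi> e d))"

lemma validI:
  assumes "\<And>e c. cond c \<Longrightarrow> (\<And>\<phi> d. \<phi> \<in> \<Gamma> \<Longrightarrow> d \<le> c \<Longrightarrow> cond d \<Longrightarrow> \<not> forces \<phi> e d) \<Longrightarrow> False"
  shows "valid \<Gamma>"
  using assms unfolding valid_def by meson

text \<open>Below every extension of \<open>c\<close> validity offers a forced formula, which cannot
  be a side formula, so \<phi> is forced densely. This rids each rule of its context.\<close>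

lemma valid_insertE:
  assumes "valid (insert \<phi> \<Gamma>)" "cond c"
    "\<And>\<psi> d. \<psi> \<in> \<Gamma> \<Longrightarrow> d \<le> c \<Longrightarrow> cond d \<Longrightarrow> \<not> forces \<psi> e d"
  shows "forces \<phi> e c"
proof (rule densely_forces, unfold densely_def, intro allI impI)
  fix d assume d: "d \<le> c" "cond d"
  obtain \<psi> d' where "\<psi> \<in> insert \<phi> \<Gamma>" "d' \<le> d" "cond d'" "forces \<psi> e d'"
    using assms(1) d(2) unfolding valid_def by blast
  moreover from this d(1) have "d' \<le> c" using order_trans by blast
  ultimately show "\<exists>d'\<le>d. cond d' \<and> forces \<phi> e d'" using assms(3) by blast
qed

text \<open>Initial sequents are valid because atoms can be decided, and a cut because no condition
  forces a formula and its negation. The other logical rules follow the clauses of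
  \<open>forces\<close>.\<close>

lemma fol_provable_valid:
  assumes "T \<turnstile> \<Gamma>" "\<And>\<phi> e c. \<phi> \<in> T \<Longrightarrow> cond c \<Longrightarrow> forces \<phi> e c"
  shows "valid \<Gamma>"
  using assms(1)
proof induction
  case (init \<Gamma> a)
  show ?case
  proof (rule validI)
    fix e c
    assume c: "cond c" and no: "\<And>\<phi> d. \<phi> \<in> \<Gamma> \<Longrightarrow> d \<le> c \<Longrightarrow> cond d \<Longrightarrow> \<not> forces \<phi> e d"
    obtain d where "d \<le> c" "cond d" "forces (Pos a) e d \<or> forces (Neg a) e d"
      using forces_decide[OF c, of "Pos a" e] by auto
    with no init.hyps(2,3) show False by blast
  qed
next
  case (ax \<Gamma> \<phi>)
  show ?case by (rule validI) (use assms(2) ax in blast)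
next
  case (disj \<phi>\<^sub>1 \<phi>\<^sub>2 \<Gamma> \<phi>)
  show ?case
  proof (rule validI)
    fix e c
    assume c: "cond c" and no: "\<And>\<phi> d. \<phi> \<in> \<Gamma> \<Longrightarrow> d \<le> c \<Longrightarrow> cond d \<Longrightarrow> \<not> forces \<phi> e d"
    have "forces \<phi> e c" using valid_insertE[OF disj.IH c no] .
    then have "forces (Disj \<phi>\<^sub>1 \<phi>\<^sub>2) e c"
      using disj.hyps(2) forces_DisjI1 forces_DisjI2 by blast
    with no[OF disj.hyps(1) order_refl c] show False by contradiction
  qed
next
  case (conj \<phi>\<^sub>1 \<phi>\<^sub>2 \<Gamma>)
  show ?case
  proof (rule validI)
    fix e c
    assume c: "cond c" and no: "\<And>\<phi> d. \<phi> \<in> \<Gamma> \<Longrightarrow> d \<le> c \<Longrightarrow> cond d \<Longrightarrow> \<not> forces \<phi> e d"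
    have "forces \<phi>\<^sub>1 e c" "forces \<phi>\<^sub>2 e c"
      using valid_insertE[OF conj.IH(1) c no] valid_insertE[OF conj.IH(2) c no] by blast+
    with no[OF conj.hyps(1) order_refl c] show False by simp
  qed
next
  case (ex \<phi> \<Gamma> u)
  show ?case
  proof (rule validI)
    fix e c
    assume c: "cond c" and no: "\<And>\<phi> d. \<phi> \<in> \<Gamma> \<Longrightarrow> d \<le> c \<Longrightarrow> cond d \<Longrightarrow> \<not> forces \<phi> e d"
    have "forces \<phi> (case_nat (name_eval e u) e) c"
      using valid_insertE[OF ex.IH c no] by (simp add: forces_inst)
    then have "forces (Ex \<phi>) e c"
      by (rule forces_ExI)
    with no[OF ex.hyps(1) order_refl c] show False by contradiction
  qed
next
  case (all \<phi> \<Gamma> a)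
  show ?case
  proof (rule validI)
    fix e c
    assume c: "cond c" and no: "\<And>\<phi> d. \<phi> \<in> \<Gamma> \<Longrightarrow> d \<le> c \<Longrightarrow> cond d \<Longrightarrow> \<not> forces \<phi> e d"
    have "forces \<phi> (case_nat x e) c" for x
    proof -
      \<comment> \<open>The eigenvariable does not occur in the conclusion, so it may denote an
        arbitrary name.\<close>
      have "\<not> forces \<psi> (e(a := x)) d" if "\<psi> \<in> \<Gamma>" "d \<le> c" "cond d" for \<psi> d
      proof -
        have "forces \<psi> (e(a := x)) d = forces \<psi> e d"
          by (rule forces_cong) (use all.hyps(2) that(1) in \<open>auto simp: FV_def\<close>)
        with no[OF that] show ?thesis by simp
      qed
      then have "forces (inst (Var a) \<phi>) (e(a := x)) c"
        by (rule valid_insertE[OF all.IH c])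
      then have "forces \<phi> (case_nat x (e(a := x))) c"
        by (simp add: forces_inst name_eval_def)
      moreover have "Suc a \<notin> fv \<phi>" using all.hyps(1,2) by (auto simp: FV_def)
      then have "forces \<phi> (case_nat x (e(a := x))) c = forces \<phi> (case_nat x e) c"
        by (intro forces_cong) (auto split: nat.split)
      ultimately show ?thesis by simp
    qed
    with no[OF all.hyps(1) order_refl c] show False by simp
  qed
next
  case (cut \<phi> \<Gamma>)
  show ?case
  proof (rule validI)
    fix e c
    assume c: "cond c" and no: "\<And>\<phi> d. \<phi> \<in> \<Gamma> \<Longrightarrow> d \<le> c \<Longrightarrow> cond d \<Longrightarrow> \<not> forces \<phi> e d"
    show False
      using forces_neg_consistent[OF c valid_insertE[OF cut.IH(1) c no] valid_insertE[OF cut.IH(2) c no]] .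
  qed
qed

section \<open>The axioms are forced and \<open>TI prec\<close> is not\<close>

lemma forces_ThN:
  assumes "\<phi> \<in> ThN"
  shows "forces \<phi> e c"
  by (rule holds_imp_forces) (use assms in \<open>auto simp: ThN_def pSigma_def tame_X_free holds_def\<close>)

text \<open>A condition forcing the negation forces the base and the step and, below it, a
  counterexample. Running \<open>good_induction\<close> at every coordinate contradicts one of the
  three.\<close>

lemma forces_ind_axiom:
  assumes "\<phi> \<in> pSigmaX 1"
  shows "forces (ind_axiom \<phi>) e c"
proof (rule forcesI)
  let ?suc = "subst_fm (case_nat (plus_tm (Var 0) one_tm) (\<lambda>n. Var (Suc n))) \<phi>"
  obtain \<psi> where \<psi>: "\<phi> = Ex \<psi>" "tame \<psi>" "local \<psi>"
    using pSigmaX_1_cases[OF assms] .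
  have tame: "tame \<phi>" using \<psi> by simp
  have suc: "forces ?suc (case_nat x e) d = forces \<phi> (case_nat (\<lambda>i. Suc (x i)) e) d" for x d
  proof -
    have "(\<lambda>n. name_eval (case_nat x e) (case_nat (plus_tm (Var 0) one_tm) (\<lambda>n. Var (Suc n)) n)) =
        case_nat (\<lambda>i. Suc (x i)) e"
      by (auto simp: fun_eq_iff name_eval_def split: nat.split)
    then show ?thesis by (simp add: forces_subst)
  qed
  fix d assume d: "d \<le> c" "cond d"
  show "\<not> forces (neg (ind_axiom \<phi>)) e d"
  proof
    assume "forces (neg (ind_axiom \<phi>)) e d"
    then have zero: "forces \<phi> (case_nat (\<lambda>_. 0) e) d"
      and step: "\<And>x. densely (\<lambda>d. forces (neg \<phi>) (case_nat x e) d \<or>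
        forces \<phi> (case_nat (\<lambda>i. Suc (x i)) e) d) d"
      and "densely (\<lambda>d. \<exists>t. forces (neg \<phi>) (case_nat t e) d) d"
      by (simp_all add: ind_axiom_def imp_def suc forces_inst name_eval_def)
    \<comment> \<open>The counterexample is a name: at coordinate i the induction has to run up to
      \<open>t i\<close>, which may be unbounded in i.\<close>
    then obtain t d\<^sub>1 where d\<^sub>1: "d\<^sub>1 \<le> d" "cond d\<^sub>1" "forces (neg \<phi>) (case_nat t e) d\<^sub>1"
      using d(2) denselyE by blast
    let ?sat = "\<lambda>i n S. sat S (case_nat n (\<lambda>n. e n i)) \<phi>"
    let ?P = "\<lambda>i C. \<forall>S\<in>C. \<not> ?sat i 0 S"
      and ?Q = "\<lambda>i m C. \<forall>S\<in>C. ?sat i m S \<and> \<not> ?sat i (Suc m) S"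
      and ?R = "\<lambda>i C. \<forall>S\<in>C. ?sat i (t i) S"
    have op: "\<exists>M. \<forall>S'. S' \<inter> {..<M} = S \<inter> {..<M} \<longrightarrow> ?sat i n S'" if "?sat i n S" for i n S
      using Ex_local_open[OF \<psi>(3) that[unfolded \<psi>(1)]] unfolding \<psi>(1) by blast
    have "\<forall>i k. good (Suc k) (d\<^sub>1 i) \<longrightarrow> (\<exists>m. \<exists>C\<subseteq>d\<^sub>1 i. good k C \<and> (?P i C \<or> ?Q i m C \<or> ?R i C))"
    proof (intro allI impI)
      fix i k assume "good (Suc k) (d\<^sub>1 i)"
      then show "\<exists>m. \<exists>C\<subseteq>d\<^sub>1 i. good k C \<and> (?P i C \<or> ?Q i m C \<or> ?R i C)"
        using op by (rule good_induction[where \<Phi> = "?sat i"])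
    qed
    from cond_select[OF d\<^sub>1(2), of "\<lambda>i m C. ?P i C \<or> ?Q i m C \<or> ?R i C", OF this]
    obtain x d\<^sub>2 where d\<^sub>2: "cond d\<^sub>2" "d\<^sub>2 \<le> d\<^sub>1"
      "\<forall>i. d\<^sub>2 i \<noteq> {} \<longrightarrow> ?P i (d\<^sub>2 i) \<or> ?Q i (x i) (d\<^sub>2 i) \<or> ?R i (d\<^sub>2 i)"
      by (elim exE conjE)
    \<comment> \<open>Coordinates may yield different alternatives; two splits leave only those with
      the same one.\<close>
    obtain d\<^sub>3 where d\<^sub>3: "d\<^sub>3 \<le> d\<^sub>2" "cond d\<^sub>3"
      "(\<forall>i. d\<^sub>3 i \<noteq> {} \<longrightarrow> ?P i (d\<^sub>2 i)) \<or> (\<forall>i. d\<^sub>3 i \<noteq> {} \<longrightarrow> ?Q i (x i) (d\<^sub>2 i) \<or> ?R i (d\<^sub>2 i))"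
      using cond_split[of d\<^sub>2 "\<lambda>i. ?P i (d\<^sub>2 i)" "\<lambda>i. ?Q i (x i) (d\<^sub>2 i) \<or> ?R i (d\<^sub>2 i)", OF d\<^sub>2(1,3)]
      by (elim exE conjE)
    have le: "d\<^sub>3 \<le> d" "d\<^sub>3 \<le> d\<^sub>1" using d\<^sub>3(1) d\<^sub>2(2) d\<^sub>1(1) by (blast intro: order_trans)+
    have sub: "d\<^sub>3 i \<subseteq> d\<^sub>2 i" for i using d\<^sub>3(1) by (simp add: le_fun_def)
    from d\<^sub>3(3) show False
    proof
      assume "\<forall>i. d\<^sub>3 i \<noteq> {} \<longrightarrow> ?P i (d\<^sub>2 i)"
      then have "holds d\<^sub>3 (case_nat (\<lambda>_. 0) e) (neg \<phi>)"
        using sub unfolding holds_def case_nat_names sat_neg by blast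
      then have "forces (neg \<phi>) (case_nat (\<lambda>_. 0) e) d\<^sub>3" using tame by (simp add: holds_imp_forces)
      with forces_neg_consistent[OF d\<^sub>3(2) forces_mono[OF zero le(1)]] show False .
    next
      assume "\<forall>i. d\<^sub>3 i \<noteq> {} \<longrightarrow> ?Q i (x i) (d\<^sub>2 i) \<or> ?R i (d\<^sub>2 i)"
      from cond_split[of d\<^sub>3 "\<lambda>i. ?Q i (x i) (d\<^sub>2 i)" "\<lambda>i. ?R i (d\<^sub>2 i)", OF d\<^sub>3(2) this]
      obtain d\<^sub>4 where d\<^sub>4: "d\<^sub>4 \<le> d\<^sub>3" "cond d\<^sub>4"
        "(\<forall>i. d\<^sub>4 i \<noteq> {} \<longrightarrow> ?Q i (x i) (d\<^sub>2 i)) \<or> (\<forall>i. d\<^sub>4 i \<noteq> {} \<longrightarrow> ?R i (d\<^sub>2 i))"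
        by (elim exE conjE)
      have sub': "d\<^sub>4 i \<subseteq> d\<^sub>2 i" for i using d\<^sub>4(1) sub by (auto simp: le_fun_def)
      from d\<^sub>4(3) show False
      proof
        assume "\<forall>i. d\<^sub>4 i \<noteq> {} \<longrightarrow> ?Q i (x i) (d\<^sub>2 i)"
        then have "holds d\<^sub>4 (case_nat x e) \<phi>" "holds d\<^sub>4 (case_nat (\<lambda>i. Suc (x i)) e) (neg \<phi>)"
          using sub' unfolding holds_def case_nat_names sat_neg by blast+
        then have f: "forces \<phi> (case_nat x e) d\<^sub>4" "forces (neg \<phi>) (case_nat (\<lambda>i. Suc (x i)) e) d\<^sub>4"
          using tame by (simp_all add: holds_imp_forces)
        \<comment> \<open>The disjunction in the step is forced only densely, so the contradiction
          appears below one further condition.\<close>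
        obtain d\<^sub>5 where d\<^sub>5: "d\<^sub>5 \<le> d\<^sub>4" "cond d\<^sub>5"
          "forces (neg \<phi>) (case_nat x e) d\<^sub>5 \<or> forces \<phi> (case_nat (\<lambda>i. Suc (x i)) e) d\<^sub>5"
          using denselyE[OF densely_mono[OF step order_trans[OF d\<^sub>4(1) le(1)]] d\<^sub>4(2)] by blast
        show False
          using d\<^sub>5(3) forces_neg_consistent[OF d\<^sub>5(2)] f[THEN forces_mono[OF _ d\<^sub>5(1)]] by blast
      next
        assume "\<forall>i. d\<^sub>4 i \<noteq> {} \<longrightarrow> ?R i (d\<^sub>2 i)"
        then have "holds d\<^sub>4 (case_nat t e) \<phi>"
          using sub' unfolding holds_def case_nat_names by blast
        then have "forces \<phi> (case_nat t e) d\<^sub>4" using tame by (simp add: holds_imp_forces)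
        from forces_neg_consistent[OF d\<^sub>4(2) this forces_mono[OF d\<^sub>1(3) order_trans[OF d\<^sub>4(1) le(2)]]]
        show False .
      qed
    qed
  qed
qed

text \<open>For a name \<open>n\<close> of an alleged least element, \<open>good_descend\<close> at
  each coordinate either excludes its value or adds a smaller one; the latter form a name refuting
  minimality.\<close>

lemma not_forces_TI:
  assumes "cond c"
  shows "\<not> forces (TI_concl prec) e c"
proof
  assume "forces (TI_concl prec) e c"
  then have "densely (\<lambda>d. \<exists>n. \<forall>x. forces (TI_matrix prec) (case_nat x (case_nat n e)) d) c"
    by (simp add: TI_concl_eq)
  then obtain n d where d: "d \<le> c" "cond d"
    "\<And>x. forces (TI_matrix prec) (case_nat x (case_nat n e)) d"
    using assms denselyE by blast
  let ?Q = "\<lambda>i m C. \<forall>S\<in>C. n i \<in> S \<longrightarrow> m \<in> S \<and> prec m (n i)"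
  have "\<forall>i k. good (Suc k) (d i) \<longrightarrow> (\<exists>m. \<exists>C\<subseteq>d i. good k C \<and> ?Q i m C)"
    by (intro allI impI good_descend)
  from cond_select[OF d(2), of ?Q, OF this]
  obtain m d' where d': "cond d'" "d' \<le> d" "\<forall>i. d' i \<noteq> {} \<longrightarrow> ?Q i (m i) (d' i)"
    by (elim exE conjE)
  have "\<not> sat S (case_nat (m i) (case_nat (n i) (\<lambda>n. e n i))) (TI_matrix prec)" if "S \<in> d' i" for i S
    using d'(3) that by (auto simp: sat_TI_matrix)
  then have "holds d' (case_nat m (case_nat n e)) (neg (TI_matrix prec))"
    by (simp add: holds_def case_nat_names)
  then have "forces (neg (TI_matrix prec)) (case_nat m (case_nat n e)) d'"
    by (intro holds_imp_forces) (simp_all add: tame_TI_matrix)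
  with d'(1) forces_mono[OF d(3) d'(2)] show False by (rule forces_neg_consistent)
qed

lemma ISigmaX_not_proves_TI: "\<not> ISigmaX_proves_TI 1 prec"
proof
  assume "ISigmaX_proves_TI 1 prec"
  then have valid: "valid {Disj TI_hyp (TI_concl prec)}"
    unfolding ISigmaX_proves_TI_def
    by (rule fol_provable_valid) (auto simp: ISigmaX_def forces_ThN intro: forces_ind_axiom simp del: pSigmaX.simps)
  \<comment> \<open>Coordinate k starts with room \<omega>^k and the guaranteed member
    \<open>m k\<close>, so that \<open>m\<close> names an element of X.\<close>
  have "\<exists>m C. good k C \<and> (\<forall>S\<in>C. m \<in> S)" for k using good_start by blast
  then obtain m c where c: "\<And>k. good k (c k)" "\<And>k S. S \<in> c k \<Longrightarrow> m k \<in> S" by metis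
  have "cond c" unfolding cond_def using c(1) by blast
  then obtain d e where d: "d \<le> c" "cond d" "forces (Disj TI_hyp (TI_concl prec)) e d"
    using valid unfolding valid_def by blast
  then obtain d' where d': "d' \<le> d" "cond d'" "forces TI_hyp e d' \<or> forces (TI_concl prec) e d'"
    by (auto elim: denselyE)
  then have "forces (Neg (InX (Var 0))) (case_nat m e) d'"
    using not_forces_TI by (auto simp: TI_hyp_def)
  moreover have "holds c (case_nat m e) (Pos (InX (Var 0)))"
    using c(2) by (auto simp: holds_def)
  then have "forces (Pos (InX (Var 0))) (case_nat m e) d'"
    using holds_mono d(1) d'(1) by (intro holds_imp_forces) (auto intro: order_trans)
  ultimately show False using forces_neg_consistent[OF d'(2), of "Pos (InX (Var 0))"] by auto
qed

end

section \<open>From comparisons of order types to embeddings\<close>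

lemma strict_well_order_irrefl: "strict_well_order prec \<Longrightarrow> \<not> prec x x"
  and strict_well_order_trans: "strict_well_order prec \<Longrightarrow> prec x y \<Longrightarrow> prec y z \<Longrightarrow> prec x z"
  unfolding strict_well_order_def strict_linear_order_on_def trans_def irrefl_def by blast+

text \<open>The map \<open>g\<close> places the power of \<omega> inside \<open>r\<close>: it is
  \<open>Inl\<close> for the height bound, where \<open>r\<close> is a sum, and the identity for
  unprovability.\<close>

lemma omega_embeddingI:
  assumes prec: "strict_well_order prec"
    and f: "inj_on f (Field r)" "\<And>x y. (x, y) \<in> r \<Longrightarrow> (f x, f y) \<in> otp prec"
    and g: "inj g" "\<And>x y. (x, y) \<in> \<omega>_pow s \<Longrightarrow> (g x, g y) \<in> r"
    and s: "Field s = H" "\<And>x y. (x, y) \<in> s \<Longrightarrow> x \<le> y"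
    and H: "\<And>j. Suc j \<in> H \<Longrightarrow> j \<in> H"
  shows "omega_embedding prec H (\<lambda>x. f (g x))"
proof
  fix a b :: "nat \<Rightarrow> nat" and z
  assume "finite {x. a x \<noteq> 0}" "finite {x. b x \<noteq> 0}" "{x. a x \<noteq> 0} \<subseteq> H" "{x. b x \<noteq> 0} \<subseteq> H"
    and z: "a z < b z" "\<And>y. z < y \<Longrightarrow> a y = b y"
  \<comment> \<open>Arguments beyond z in \<open>s\<close> are also numerically beyond z, where the
    two normal forms agree.\<close>
  moreover have "\<forall>y. (z, y) \<in> s \<and> y \<noteq> z \<longrightarrow> a y = b y"
    using s(2) z(2) by (simp add: order_less_le)
  ultimately have "(a, b) \<in> \<omega>_pow s"
    unfolding \<omega>_pow_def using s(1) by blast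
  then have ab: "(g a, g b) \<in> r" by (rule g(2))
  have "g a \<noteq> g b" using g(1) z(1) by (metis injD less_irrefl)
  then have "f (g a) \<noteq> f (g b)"
    using ab inj_onD[OF f(1)] by (metis FieldI1 FieldI2)
  with f(2)[OF ab] show "prec (f (g a)) (f (g b))" by (auto simp: otp_def)
qed (use strict_well_order_irrefl[OF prec] strict_well_order_trans[OF prec] H in blast)+

theorem corollary3p17:
  fixes prec :: "nat \<Rightarrow> nat \<Rightarrow> bool"
  assumes "strict_well_order prec"
  shows "(\<forall>(h::nat) \<tau> lab.
            derivation 1 \<tau> lab (TI prec) \<and> \<omega>_pow (natLeq_on (h + 1)) \<oplus>\<^sub>o natLeq <o otp prec
              \<longrightarrow> height \<tau> > h)
       \<and> (\<omega>_pow natLeq \<le>o otp prec \<longrightarrow> \<not> ISigmaX_proves_TI 1 prec)"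
proof (intro conjI allI impI; (elim conjE)?)
  fix h \<tau> lab
  assume der: "derivation 1 \<tau> lab (TI prec)"
    and less: "\<omega>_pow (natLeq_on (h + 1)) \<oplus>\<^sub>o natLeq <o otp prec"
  let ?s = "natLeq_on (h + 1)"
  let ?r = "\<omega>_pow ?s \<oplus>\<^sub>o natLeq"
  obtain f where W: "Well_order ?r" and f: "embed ?r (otp prec) f"
    using less unfolding ordLess_def embedS_def by blast
  have "inj_on f (Field ?r)" using embed_inj_on[OF W f] .
  moreover have "(f x, f y) \<in> otp prec" if "(x, y) \<in> ?r" for x y
    using embed_compat[OF f] that by (auto simp: compat_def)
  ultimately have "omega_embedding prec (Field ?s) (\<lambda>x. f (Inl x))"
    by (rule omega_embeddingI[OF assms, where r = ?r])
      (auto simp: ord_plus_def Field_natLeq_on)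
  then interpret omega_embedding prec "Field ?s" "\<lambda>x. f (Inl x)" .
  show "height \<tau> > h"
  proof (rule ccontr)
    assume "\<not> height \<tau> > h"
    then have "deriv h (TI prec)" using derivation_imp_deriv[OF der] by simp
    \<comment> \<open>The exponents below h + 1 include h, so a starting cone with room \<omega>^h
      exists: one exponent for each of at most h successive inferences.\<close>
    moreover have "h \<in> Field ?s" by (simp add: Field_natLeq_on)
    ultimately show False using not_deriv_TI by blast
  qed
next
  assume leq: "\<omega>_pow natLeq \<le>o otp prec"
  obtain f where W: "Well_order (\<omega>_pow natLeq)" and f: "embed (\<omega>_pow natLeq) (otp prec) f"
    using leq unfolding ordLeq_def by blast
  have "inj_on f (Field (\<omega>_pow natLeq))" using embed_inj_on[OF W f] .
  moreover have "(f x, f y) \<in> otp prec" if "(x, y) \<in> \<omega>_pow natLeq" for x y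
    using embed_compat[OF f] that by (auto simp: compat_def)
  ultimately have "omega_embedding prec UNIV (\<lambda>x. f (id x))"
    by (rule omega_embeddingI[OF assms, where r = "\<omega>_pow natLeq" and s = natLeq])
      (auto simp: Field_natLeq, auto simp: natLeq_def)
  then interpret omega_embeddings prec "\<lambda>x. f (id x)" by (simp add: omega_embeddings_def)
  show "\<not> ISigmaX_proves_TI 1 prec" by (rule ISigmaX_not_proves_TI)
qed

end
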